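(* Let $\mathcal H=\bigoplus_{m\ge0}\mathcal H_m$ be a graded connected Hopf algebra over $\mathbb R$ (each $\mathcal H_m$ finite-dimensional) with a basis $\mathcal B=\bigsqcup_m\mathcal B_m$ such that $\mathcal B_1=\{\bullet\}$ and, for each $m\ge1$ and $x\in\mathcal B_m$, $\Delta_{1,m-1}(x)=\bullet\otimes D(x)$ for some $D(x)\in\mathcal B_{m-1}$; assume also that for all $z\in\mathcal B_{m-1}$ the product $\bullet z$ has non-negative coefficients in $\mathcal B_m$ (so that the chains below are defined; here $\eta\equiv1$). Let $1\le k\le n$ and $q_2\in[0,1]$. Then: (i) the Markov chain on $\mathcal B_n$ driven by $\mathrm{T2R}_n$ lumps via $D^{n-k}$ to the $\frac{n-k}{n}$-lazy version of the Markov chain on $\mathcal B_k$ driven by $\mathrm{T2R}_k$; (ii) the Markov chain on $\mathcal B_n$ driven by $\mathrm{BinT2R}_n(q_2)$ lumps via $D^{n-k}$ to the Markov chain on $\mathcal B_k$ driven by $\mathrm{BinT2R}_k(q_2)$.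
   Context: $\Delta_{1,m-1}$ is the coproduct projected to $\mathcal H_1\otimes\mathcal H_{m-1}$; more generally $\Delta_{1^r,m-r}$ is the iterated coproduct $(\Delta\otimes\mathrm{id}^{\otimes r-1})\circ\cdots\circ\Delta$ projected to $\mathcal H_1^{\otimes r}\otimes\mathcal H_{m-r}$, and $m\Delta_{1^r,m-r}$ is this followed by multiplication (with $1^0$ meaning a single part $0$). $\mathrm{T2R}_m=\frac1m m\Delta_{1,m-1}$ and $\mathrm{BinT2R}_m(q_2)=\sum_{r=0}^m\frac1{r!}(1-q_2)^rq_2^{m-r}m\Delta_{1^r,m-r}$. Under the hypotheses, the Markov chain on $\mathcal B_m$ driven by an operator $\mathrm T$ has transition matrix $\hat K(x,y)=$ coefficient of $y$ in $\mathrm T(x)$. The $\alpha$-lazy version of a chain with transition matrix $K$ has transition matrix $\alpha\,\mathrm{id}+(1-\alpha)K$. A chain $\{X_t\}$ on $\Omega$ lumps via a surjection $\theta:\Omega\to\bar\Omega$ to a chain $\{\bar X_t\}$ if $\{\theta(X_t)\}$ is a Markov chain with the same transition matrix as $\{\bar X_t\}$ (for every initial state). *)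

theory Defs
  imports "HOL-Probability.Probability" "HOL-Analysis.Finite_Function_Topology"
begin

section \<open>Tensor powers of a real vector space\<close>

text \<open>All tensor powers of a real vector space live in one type, its tensor algebra: the free
  real vector space on finite lists of vectors, modulo linearity in each entry. The list
  \<open>[x\<^sub>1, \<dots>, x\<^sub>r]\<close> stands for the pure tensor of \<open>x\<^sub>1, \<dots>, x\<^sub>r\<close>, and the span of
  the pure tensors of length \<open>r\<close> is the \<open>r\<close>-th tensor power.\<close>

definition tensor_null :: "('a::real_vector list \<Rightarrow>\<^sub>0 real) set" where
  "tensor_null = span
     ({Poly_Mapping.single (us @ (a + b) # vs) 1 - Poly_Mapping.single (us @ a # vs) 1
         - Poly_Mapping.single (us @ b # vs) 1 | us a b vs. True} \<union>
      {Poly_Mapping.single (us @ (c *\<^sub>R a) # vs) 1 - c *\<^sub>R Poly_Mapping.single (us @ a # vs) 1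
         | us c a vs. True})"

definition tensor_rel :: "('a::real_vector list \<Rightarrow>\<^sub>0 real) \<Rightarrow> ('a list \<Rightarrow>\<^sub>0 real) \<Rightarrow> bool" where
  "tensor_rel p q \<longleftrightarrow> p - q \<in> tensor_null"

lemma subspace_tensor_null: "subspace tensor_null"
  by (simp add: tensor_null_def)

lemma equivp_tensor_rel: "equivp (tensor_rel :: ('a::real_vector list \<Rightarrow>\<^sub>0 real) \<Rightarrow> _)"
proof (rule equivpI)
  let ?R = "tensor_rel :: ('a list \<Rightarrow>\<^sub>0 real) \<Rightarrow> _"
  show "reflp ?R"
    by (simp add: reflp_def tensor_rel_def subspace_tensor_null subspace_0)
  show "symp ?R"
    unfolding symp_def tensor_rel_def
    by (metis minus_diff_eq subspace_neg subspace_tensor_null)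
  show "transp ?R"
    unfolding transp_def tensor_rel_def
  proof (intro allI impI)
    fix p q r :: "'a list \<Rightarrow>\<^sub>0 real"
    assume "p - q \<in> tensor_null" "q - r \<in> tensor_null"
    then have "(p - q) + (q - r) \<in> tensor_null"
      by (rule subspace_add[OF subspace_tensor_null])
    then show "p - r \<in> tensor_null" by simp
  qed
qed

quotient_type (overloaded) 'a tensor = "'a::real_vector list \<Rightarrow>\<^sub>0 real" / tensor_rel
  by (rule equivp_tensor_rel)

instantiation tensor :: (real_vector) real_vector
begin

lift_definition zero_tensor :: "'a tensor" is "0" .

lift_definition plus_tensor :: "'a tensor \<Rightarrow> 'a tensor \<Rightarrow> 'a tensor" is "(+)"
  unfolding tensor_rel_def add_diff_add
  by (rule subspace_add[OF subspace_tensor_null])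

lift_definition uminus_tensor :: "'a tensor \<Rightarrow> 'a tensor" is "uminus"
  unfolding tensor_rel_def minus_diff_minus
  by (rule subspace_neg[OF subspace_tensor_null])

lift_definition minus_tensor :: "'a tensor \<Rightarrow> 'a tensor \<Rightarrow> 'a tensor" is "(-)"
proof -
  fix p p' q q' :: "'a list \<Rightarrow>\<^sub>0 real"
  assume "tensor_rel p p'" "tensor_rel q q'"
  then have "(p - p') - (q - q') \<in> tensor_null"
    unfolding tensor_rel_def by (rule subspace_diff[OF subspace_tensor_null])
  then show "tensor_rel (p - q) (p' - q')"
    by (simp add: tensor_rel_def algebra_simps)
qed

lift_definition scaleR_tensor :: "real \<Rightarrow> 'a tensor \<Rightarrow> 'a tensor" is "scaleR"
  unfolding tensor_rel_def scaleR_right_diff_distrib[symmetric]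
  by (rule subspace_scale[OF subspace_tensor_null])

instance
  by standard
    (transfer; simp add: tensor_rel_def subspace_0 subspace_tensor_null algebra_simps)+

end

lift_definition pure :: "'a::real_vector list \<Rightarrow> 'a tensor" is
  "\<lambda>xs. Poly_Mapping.single xs 1" .

definition multilinear :: "('a::real_vector list \<Rightarrow> 'b::real_vector) \<Rightarrow> bool" where
  "multilinear f \<longleftrightarrow>
     (\<forall>us a b vs. f (us @ (a + b) # vs) = f (us @ a # vs) + f (us @ b # vs)) \<and>
     (\<forall>us c a vs. f (us @ (c *\<^sub>R a) # vs) = c *\<^sub>R f (us @ a # vs))"

text \<open>The linear map with prescribed values on pure tensors; it exists and is unique as soon as
  the prescription is multilinear.\<close>

definition tlift :: "('a::real_vector list \<Rightarrow> 'b::real_vector) \<Rightarrow> 'a tensor \<Rightarrow> 'b" where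
  "tlift f = (THE g. linear g \<and> (\<forall>xs. g (pure xs) = f xs))"

lemma multilinear_pure: "multilinear pure"
  unfolding multilinear_def
proof (intro conjI allI)
  show "pure (us @ (a + b) # vs) = pure (us @ a # vs) + pure (us @ b # vs)"
    for us :: "'a list" and a b vs
    by (transfer, unfold tensor_rel_def tensor_null_def, rule span_base)
      (force simp: algebra_simps)
  show "pure (us @ (c *\<^sub>R a) # vs) = c *\<^sub>R pure (us @ a # vs)"
    for us :: "'a list" and a c vs
    by (transfer, unfold tensor_rel_def tensor_null_def, rule span_base) force
qed

lemma lookup_scaleR_pm: "Poly_Mapping.lookup (c *\<^sub>R p) x = c *\<^sub>R Poly_Mapping.lookup p x"
  for p :: "'a \<Rightarrow>\<^sub>0 'b::real_vector"
proof -
  have "{x. c *\<^sub>R Poly_Mapping.lookup p x \<noteq> 0} \<subseteq> Poly_Mapping.keys p"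
    by (auto simp: in_keys_iff)
  then have "finite {x. c *\<^sub>R Poly_Mapping.lookup p x \<noteq> 0}"
    using finite_keys finite_subset by blast
  then show ?thesis
    by (simp add: scaleR_poly_mapping_def)
qed

lemma pm_span: "p \<in> span (range (\<lambda>x. Poly_Mapping.single x (1::real)))"
proof -
  have "p = (\<Sum>x\<in>Poly_Mapping.keys p.
      Poly_Mapping.lookup p x *\<^sub>R Poly_Mapping.single x 1)"
    by (rule poly_mapping_eqI)
      (auto simp: lookup_sum lookup_scaleR_pm lookup_single when_def in_keys_iff if_distrib
        cong: if_cong)
  also have "\<dots> \<in> span (range (\<lambda>x. Poly_Mapping.single x (1::real)))"
    by (intro span_sum span_scale span_base) auto
  finally show ?thesis .
qed

lemma linear_abs_tensor: "linear abs_tensor"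
  by (rule linearI) (simp_all add: plus_tensor.abs_eq scaleR_tensor.abs_eq)

lemma pure_eq_abs: "pure xs = abs_tensor (Poly_Mapping.single xs 1)"
  by (simp add: pure.abs_eq)

lemma span_pure: "span (range pure) = UNIV"
proof -
  have "t \<in> span (range pure)" for t :: "'a tensor"
  proof -
    obtain p where p: "t = abs_tensor p"
      by (rule that[of "rep_tensor t"]) (simp only: Quotient_abs_rep[OF Quotient_tensor])
    have "abs_tensor p \<in> abs_tensor ` span (range (\<lambda>x. Poly_Mapping.single x (1::real)))"
      using pm_span by blast
    also have "\<dots> = span (abs_tensor ` range (\<lambda>x. Poly_Mapping.single x (1::real)))"
      by (rule linear_span_image[OF linear_abs_tensor, symmetric])
    also have "abs_tensor ` range (\<lambda>x. Poly_Mapping.single x (1::real)) = range pure"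
      by (auto simp: pure_eq_abs)
    finally show ?thesis by (simp add: p)
  qed
  then show ?thesis by blast
qed

lemma tensor_linear_eqI:
  assumes "linear g" "linear h" "\<And>xs. g (pure xs) = h (pure xs)"
  shows "g = h"
proof
  fix t show "g t = h t"
    by (rule linear_eq_on_span[OF assms(1,2), of "range pure"])
      (use assms(3) span_pure in auto)
qed

lemma tlift_exists:
  assumes "multilinear f"
  shows "\<exists>g. linear g \<and> (\<forall>xs. g (pure xs) = f xs)"
proof -
  define h where
    "h p = (\<Sum>xs\<in>Poly_Mapping.keys p. Poly_Mapping.lookup p xs *\<^sub>R f xs)" for p
  have h_eq: "h p = (\<Sum>xs\<in>A. Poly_Mapping.lookup p xs *\<^sub>R f xs)"
    if "finite A" "Poly_Mapping.keys p \<subseteq> A" for A p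
    unfolding h_def using that by (intro sum.mono_neutral_left) (auto simp: in_keys_iff)
  have lin: "linear h"
  proof (rule linearI)
    show "h (p + q) = h p + h q" for p q
    proof -
      let ?A = "Poly_Mapping.keys p \<union> Poly_Mapping.keys q"
      have "h (p + q) = (\<Sum>xs\<in>?A. Poly_Mapping.lookup (p + q) xs *\<^sub>R f xs)"
        by (intro h_eq) (auto dest: subsetD[OF Poly_Mapping.keys_add])
      also have "\<dots> = h p + h q"
        by (simp add: h_eq[of ?A] lookup_add scaleR_add_left sum.distrib)
      finally show ?thesis .
    qed
    show "h (c *\<^sub>R p) = c *\<^sub>R h p" for c p
    proof -
      have "h (c *\<^sub>R p) = (\<Sum>xs\<in>Poly_Mapping.keys p. Poly_Mapping.lookup (c *\<^sub>R p) xs *\<^sub>R f xs)"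
        by (intro h_eq) (auto simp: in_keys_iff lookup_scaleR_pm)
      then show ?thesis
        by (simp add: h_def lookup_scaleR_pm scaleR_sum_right)
    qed
  qed
  have single: "h (Poly_Mapping.single xs 1) = f xs" for xs
    by (simp add: h_def)
  have null: "h p = 0" if "p \<in> tensor_null" for p
    using that unfolding tensor_null_def
  proof (rule linear_eq_0_on_span[OF lin, rotated])
    fix q :: "'a list \<Rightarrow>\<^sub>0 real"
    assume "q \<in> {Poly_Mapping.single (us @ (a + b) # vs) 1 - Poly_Mapping.single (us @ a # vs) 1
         - Poly_Mapping.single (us @ b # vs) 1 | us a b vs. True} \<union>
      {Poly_Mapping.single (us @ (c *\<^sub>R a) # vs) 1 - c *\<^sub>R Poly_Mapping.single (us @ a # vs) 1
         | us c a vs. True}"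
    then show "h q = 0"
      using assms
      by (auto simp: linear_diff[OF lin] linear_cmul[OF lin] single multilinear_def)
  qed
  have rel: "h p = h q" if "tensor_rel p q" for p q
    using null[of "p - q"] that by (simp add: tensor_rel_def linear_diff[OF lin])
  define g where "g t = h (rep_tensor t)" for t
  have g: "g (abs_tensor p) = h p" for p
    unfolding g_def
    by (rule rel) (simp only: tensor.abs_eq_iff[symmetric] Quotient_abs_rep[OF Quotient_tensor])
  have "linear g"
  proof (rule linearI)
    show "g (s + t) = g s + g t" for s t
      by (induct s; induct t) (simp add: plus_tensor.abs_eq g linear_add[OF lin])
    show "g (c *\<^sub>R t) = c *\<^sub>R g t" for c t
      by (induct t) (simp add: scaleR_tensor.abs_eq g linear_cmul[OF lin])
  qed
  moreover have "g (pure xs) = f xs" for xs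
    by (simp add: pure_eq_abs g single)
  ultimately show ?thesis by blast
qed

lemma tlift:
  assumes "multilinear f"
  shows linear_tlift: "linear (tlift f)" and tlift_pure: "tlift f (pure xs) = f xs"
proof -
  have "\<exists>!g. linear g \<and> (\<forall>xs. g (pure xs) = f xs)"
    by (rule ex_ex1I[OF tlift_exists[OF assms]]) (auto intro!: tensor_linear_eqI)
  from theI'[OF this]
  show "linear (tlift f)" "tlift f (pure xs) = f xs"
    by (auto simp: tlift_def)
qed

text \<open>The product of the tensor algebra, which joins a tensor of length \<open>r\<close> and one of length
  \<open>s\<close> to a tensor of length \<open>r + s\<close>.\<close>

definition tconcat :: "'a::real_vector tensor \<Rightarrow> 'a tensor \<Rightarrow> 'a tensor" where
  "tconcat s t = tlift (\<lambda>xs. tlift (\<lambda>ys. pure (xs @ ys)) t) s"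

text \<open>The linear map on the second tensor power induced by a bilinear map (and zero on the other
  tensor powers).\<close>

definition tlift2 ::
  "('a::real_vector \<Rightarrow> 'a \<Rightarrow> 'b::real_vector) \<Rightarrow> 'a tensor \<Rightarrow> 'b" where
  "tlift2 b = tlift (\<lambda>xs. case xs of [x, y] \<Rightarrow> b x y | _ \<Rightarrow> 0)"

lemma multilinear_append_left: "multilinear f \<Longrightarrow> multilinear (\<lambda>ys. f (xs @ ys))"
  by (simp add: multilinear_def flip: append_assoc)

lemma multilinear_tconcat_aux:
  "multilinear (\<lambda>xs. tlift (\<lambda>ys. pure (xs @ ys)) t)"
proof -
  let ?F = "\<lambda>xs. tlift (\<lambda>ys. pure (xs @ ys))"
  have lin: "linear (?F xs)" for xs :: "'a list"
    by (intro linear_tlift multilinear_append_left multilinear_pure)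
  have val: "?F xs (pure ys) = pure (xs @ ys)" for xs ys :: "'a list"
    by (intro tlift_pure multilinear_append_left multilinear_pure)
  have "?F (us @ (a + b) # vs) = (\<lambda>t. ?F (us @ a # vs) t + ?F (us @ b # vs) t)"
    for us vs :: "'a list" and a b
  proof (rule tensor_linear_eqI)
    show "?F (us @ (a + b) # vs) (pure ys) =
        ?F (us @ a # vs) (pure ys) + ?F (us @ b # vs) (pure ys)" for ys
      unfolding val using multilinear_pure[where 'a = 'a] by (simp add: multilinear_def)
  qed (intro lin linear_compose_add)+
  moreover have "?F (us @ (c *\<^sub>R a) # vs) = (\<lambda>t. c *\<^sub>R ?F (us @ a # vs) t)"
    for us vs :: "'a list" and a c
  proof (rule tensor_linear_eqI)
    show "?F (us @ (c *\<^sub>R a) # vs) (pure ys) = c *\<^sub>R ?F (us @ a # vs) (pure ys)" for ys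
      unfolding val using multilinear_pure[where 'a = 'a] by (simp add: multilinear_def)
  qed (intro lin linear_compose_scale_right)+
  ultimately show ?thesis
    unfolding multilinear_def by metis
qed

lemma tconcat_pure: "tconcat (pure xs) (pure ys) = pure (xs @ ys)"
  unfolding tconcat_def tlift_pure[OF multilinear_tconcat_aux]
  by (rule tlift_pure[OF multilinear_append_left[OF multilinear_pure]])

lemma multilinear_nth_linear:
  assumes "\<And>us vs. linear (\<lambda>a. f (us @ a # vs))"
  shows "multilinear f"
  unfolding multilinear_def
  using linear_add[OF assms] linear_cmul[OF assms] by blast

lemma tlift2_multilinear:
  assumes "bilinear b"
  shows "multilinear (\<lambda>xs. case xs of [x, y] \<Rightarrow> b x y | _ \<Rightarrow> 0)"
proof (rule multilinear_nth_linear)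
  fix us vs :: "'a list"
  have l: "linear (b x)" "linear (\<lambda>x. b x y)" for x y
    using assms by (auto simp: bilinear_def)
  show "linear (\<lambda>a. case us @ a # vs of [x, y] \<Rightarrow> b x y | _ \<Rightarrow> 0)"
  proof (cases us)
    case Nil
    then show ?thesis
      by (cases vs; cases "tl vs") (simp_all add: l linear_zero)
  next
    case (Cons u us')
    then show ?thesis
      by (cases us'; cases "tl us'"; cases vs) (simp_all add: l linear_zero)
  qed
qed

lemma tlift2:
  assumes "bilinear b"
  shows linear_tlift2: "linear (tlift2 b)" and tlift2_pure: "tlift2 b (pure [x, y]) = b x y"
  unfolding tlift2_def
  using tlift[OF tlift2_multilinear[OF assms]] by auto

lemma bilinear_tconcat: "bilinear (tconcat :: 'a::real_vector tensor \<Rightarrow> _)"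
  unfolding bilinear_def
proof (intro conjI allI)
  fix s t :: "'a tensor"
  show left: "linear (\<lambda>s. tconcat s t)" for t :: "'a tensor"
    unfolding tconcat_def by (rule linear_tlift[OF multilinear_tconcat_aux])
  have pure: "linear (tconcat (pure xs))" for xs :: "'a list"
    unfolding tconcat_def tlift_pure[OF multilinear_tconcat_aux]
    by (rule linear_tlift[OF multilinear_append_left[OF multilinear_pure]])
  show "linear (tconcat s)"
  proof (rule linearI)
    show "tconcat s (u + v) = tconcat s u + tconcat s v" for u v
      using tensor_linear_eqI[of "\<lambda>s. tconcat s (u + v)" "\<lambda>s. tconcat s u + tconcat s v"]
      by (metis left linear_compose_add linear_add[OF pure])
    show "tconcat s (c *\<^sub>R u) = c *\<^sub>R tconcat s u" for c u
      using tensor_linear_eqI[of "\<lambda>s. tconcat s (c *\<^sub>R u)" "\<lambda>s. c *\<^sub>R tconcat s u"]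
      by (metis left linear_compose_scale_right linear_cmul[OF pure])
  qed
qed

section \<open>Graded connected Hopf algebras\<close>

definition graded_decomp :: "(nat \<Rightarrow> 'h::real_vector set) \<Rightarrow> 'h \<Rightarrow> (nat \<Rightarrow> 'h) \<Rightarrow> bool" where
  "graded_decomp H x f \<longleftrightarrow>
     (\<forall>m. f m \<in> H m) \<and> finite {m. f m \<noteq> 0} \<and> x = (\<Sum>m | f m \<noteq> 0. f m)"

definition component :: "(nat \<Rightarrow> 'h::real_vector set) \<Rightarrow> nat \<Rightarrow> 'h \<Rightarrow> 'h" where
  "component H m x = (THE f. graded_decomp H x f) m"

text \<open>The product of the algebra \<open>H \<otimes> H\<close>:
  \<open>(a \<otimes> b) (c \<otimes> d) = ac \<otimes> bd\<close>.\<close>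

definition tmult2 :: "'h::real_algebra_1 tensor \<Rightarrow> 'h tensor \<Rightarrow> 'h tensor" where
  "tmult2 s t = tlift2 (\<lambda>a b. tlift2 (\<lambda>c d. pure [a * c, b * d]) t) s"

locale graded_connected_hopf_algebra =
  fixes H :: "nat \<Rightarrow> 'h::real_algebra_1 set"
    and \<Delta> :: "'h \<Rightarrow> 'h tensor"
    and \<epsilon> :: "'h \<Rightarrow> real"
    and S :: "'h \<Rightarrow> 'h"
  assumes subspace_H: "subspace (H m)"
    and finite_dim_H: "\<exists>F. finite F \<and> span F = H m"
    and direct_sum: "\<exists>!f. graded_decomp H x f"
    and connected: "H 0 = span {1}"
    and mult_graded: "x \<in> H i \<Longrightarrow> y \<in> H j \<Longrightarrow> x * y \<in> H (i + j)"
    and comult_linear: "linear \<Delta>"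
    and comult_graded:
      "x \<in> H m \<Longrightarrow> \<Delta> x \<in> span {pure [a, b] | a b i j. i + j = m \<and> a \<in> H i \<and> b \<in> H j}"
    and coassoc:
      "tlift2 (\<lambda>a b. tconcat (\<Delta> a) (pure [b])) (\<Delta> x) =
       tlift2 (\<lambda>a b. tconcat (pure [a]) (\<Delta> b)) (\<Delta> x)"
    and counit_linear: "linear \<epsilon>"
    and counit_graded: "x \<in> H m \<Longrightarrow> m \<noteq> 0 \<Longrightarrow> \<epsilon> x = 0"
    and counit_left: "tlift2 (\<lambda>a b. \<epsilon> a *\<^sub>R b) (\<Delta> x) = x"
    and counit_right: "tlift2 (\<lambda>a b. \<epsilon> b *\<^sub>R a) (\<Delta> x) = x"
    and comult_mult: "\<Delta> (x * y) = tmult2 (\<Delta> x) (\<Delta> y)"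
    and comult_one: "\<Delta> 1 = pure [1, 1]"
    and counit_mult: "\<epsilon> (x * y) = \<epsilon> x * \<epsilon> y"
    and counit_one: "\<epsilon> 1 = 1"
    and antipode_linear: "linear S"
    and antipode_left: "tlift2 (\<lambda>a b. S a * b) (\<Delta> x) = \<epsilon> x *\<^sub>R 1"
    and antipode_right: "tlift2 (\<lambda>a b. a * S b) (\<Delta> x) = \<epsilon> x *\<^sub>R 1"

definition graded_basis :: "(nat \<Rightarrow> 'h::real_vector set) \<Rightarrow> (nat \<Rightarrow> 'h set) \<Rightarrow> bool" where
  "graded_basis H B \<longleftrightarrow> (\<forall>m. independent (B m) \<and> span (B m) = H m)"

section \<open>Descent operators\<close>

text \<open>The map \<open>\<Delta> \<otimes> id \<otimes> \<dots> \<otimes> id\<close>, on all tensor powers of positive length at once.\<close>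

definition comult_first :: "('h::real_vector \<Rightarrow> 'h tensor) \<Rightarrow> 'h tensor \<Rightarrow> 'h tensor" where
  "comult_first \<Delta> = tlift (\<lambda>xs. case xs of [] \<Rightarrow> 0 | x # ys \<Rightarrow> tconcat (\<Delta> x) (pure ys))"

definition iter_comult :: "('h::real_vector \<Rightarrow> 'h tensor) \<Rightarrow> nat \<Rightarrow> 'h \<Rightarrow> 'h tensor" where
  "iter_comult \<Delta> r x = (comult_first \<Delta> ^^ r) (pure [x])"

definition tensor_component ::
  "(nat \<Rightarrow> 'h::real_vector set) \<Rightarrow> nat list \<Rightarrow> 'h tensor \<Rightarrow> 'h tensor" where
  "tensor_component H ds =
     tlift (\<lambda>xs. if length xs = length ds then pure (map2 (component H) ds xs) else 0)"

definition comult_parts ::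
  "(nat \<Rightarrow> 'h::real_vector set) \<Rightarrow> ('h \<Rightarrow> 'h tensor) \<Rightarrow> nat list \<Rightarrow> 'h \<Rightarrow> 'h tensor" where
  "comult_parts H \<Delta> ds x = tensor_component H ds (iter_comult \<Delta> (length ds - 1) x)"

definition tensor_mult :: "'h::real_algebra_1 tensor \<Rightarrow> 'h" where
  "tensor_mult = tlift prod_list"

text \<open>The composition \<open>(1\<^sup>r, m - r)\<close>, where \<open>1\<^sup>0\<close> is a single part \<open>0\<close>.\<close>

definition top_parts :: "nat \<Rightarrow> nat \<Rightarrow> nat list" where
  "top_parts r m = (if r = 0 then [0, m] else replicate r 1 @ [m - r])"

definition T2R ::
  "(nat \<Rightarrow> 'h::real_algebra_1 set) \<Rightarrow> ('h \<Rightarrow> 'h tensor) \<Rightarrow> nat \<Rightarrow> 'h \<Rightarrow> 'h" where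
  "T2R H \<Delta> m x = (1 / real m) *\<^sub>R tensor_mult (comult_parts H \<Delta> [1, m - 1] x)"

definition BinT2R ::
  "(nat \<Rightarrow> 'h::real_algebra_1 set) \<Rightarrow> ('h \<Rightarrow> 'h tensor) \<Rightarrow> real \<Rightarrow> nat \<Rightarrow> 'h \<Rightarrow> 'h" where
  "BinT2R H \<Delta> q m x =
     (\<Sum>r = 0..m. (1 / fact r * (1 - q) ^ r * q ^ (m - r)) *\<^sub>R
        tensor_mult (comult_parts H \<Delta> (top_parts r m) x))"

lemma multilinear_prod_list: "multilinear (prod_list :: 'h::real_algebra_1 list \<Rightarrow> 'h)"
  by (simp add: multilinear_def algebra_simps)

lemma tensor_mult_pure: "tensor_mult (pure xs) = prod_list xs"
  unfolding tensor_mult_def by (rule tlift_pure[OF multilinear_prod_list])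

section \<open>Markov chains and lumping\<close>

definition driven_matrix :: "'h::real_vector set \<Rightarrow> ('h \<Rightarrow> 'h) \<Rightarrow> 'h \<Rightarrow> 'h \<Rightarrow> real" where
  "driven_matrix B T x y = representation B (T x) y"

definition lazy :: "real \<Rightarrow> ('s \<Rightarrow> 's \<Rightarrow> real) \<Rightarrow> 's \<Rightarrow> 's \<Rightarrow> real" where
  "lazy \<alpha> K x y = \<alpha> * (if x = y then 1 else 0) + (1 - \<alpha>) * K x y"

definition transition_matrix :: "'s set \<Rightarrow> ('s \<Rightarrow> 's \<Rightarrow> real) \<Rightarrow> bool" where
  "transition_matrix \<Omega> K \<longleftrightarrow>
     finite \<Omega> \<and> (\<forall>x\<in>\<Omega>. (\<forall>y\<in>\<Omega>. 0 \<le> K x y) \<and> (\<Sum>y\<in>\<Omega>. K x y) = 1)"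

definition markov_chain ::
  "'w measure \<Rightarrow> 's set \<Rightarrow> ('s \<Rightarrow> 's \<Rightarrow> real) \<Rightarrow> (nat \<Rightarrow> 'w \<Rightarrow> 's) \<Rightarrow> bool" where
  "markov_chain M \<Omega> K X \<longleftrightarrow>
     prob_space M \<and> transition_matrix \<Omega> K \<and>
     (\<forall>t. X t \<in> measurable M (count_space \<Omega>)) \<and>
     (\<forall>t s. (\<forall>i\<le>Suc t. s i \<in> \<Omega>) \<longrightarrow>
        \<P>(w in M. \<forall>i\<le>t. X i w = s i) \<noteq> 0 \<longrightarrow>
        \<P>(w in M. X (Suc t) w = s (Suc t) \<bar> \<forall>i\<le>t. X i w = s i) = K (s t) (s (Suc t)))"

text \<open>The initial distribution is not part of \<open>markov_chain\<close>, so the quantifier over \<open>X\<close> ranges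
  over all starting states. Both matrices are required to be stochastic so that the condition on
  \<open>X\<close> is not void for want of chains.\<close>

definition lumps_via ::
  "'w measure \<Rightarrow> 's set \<Rightarrow> ('s \<Rightarrow> 's \<Rightarrow> real) \<Rightarrow> ('s \<Rightarrow> 'u) \<Rightarrow>
   'u set \<Rightarrow> ('u \<Rightarrow> 'u \<Rightarrow> real) \<Rightarrow> bool" where
  "lumps_via M \<Omega> K \<theta> \<Omega>' K' \<longleftrightarrow>
     transition_matrix \<Omega> K \<and> transition_matrix \<Omega>' K' \<and> \<theta> ` \<Omega> = \<Omega>' \<and>
     (\<forall>X. markov_chain M \<Omega> K X \<longrightarrow> markov_chain M \<Omega>' K' (\<lambda>t w. \<theta> (X t w)))"

end

theory Submission
  imports Defs
begin

text \<open>Let \<open>\<pi>\<close> be the functional that reads off the coefficient of \<open>pt\<close> in degree \<open>1\<close>. Contracting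
  the left tensor factor of \<open>\<Delta> x\<close> with \<open>\<pi>\<close> extends \<open>D\<close> to a linear map \<open>der\<close>. As \<open>\<pi>\<close> is
  a derivation over the counit, \<open>der\<close> is a derivation of the algebra, with \<open>der pt = 1\<close>, and by
  coassociativity multiplying out the component of degree \<open>(1\<^sup>r, m - r)\<close> of the iterated coproduct
  gives \<open>pt\<^sup>r * der\<^sup>r x\<close>. The Leibniz rule then yields the commutation of the driving operators
  with powers of \<open>der\<close>, up to the lazy part in the first case. On basis elements these are
  the row sum conditions for strong lumping by the fibres of \<open>D\<^sup>n\<^sup>-\<^sup>k\<close>. The row sums are \<open>1\<close> since
  \<open>der\<^sup>n\<close> sends every element of \<open>B n\<close> to \<open>1\<close>, and \<open>D\<close> is onto since a locally nilpotent
  derivation with \<open>der pt = 1\<close> is surjective.\<close>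

section \<open>Linear maps out of the tensor algebra\<close>

lemma tlift2_pure_case:
  assumes "bilinear b"
  shows "tlift2 b (pure xs) = (case xs of [x, y] \<Rightarrow> b x y | _ \<Rightarrow> 0)"
  unfolding tlift2_def by (rule tlift_pure[OF tlift2_multilinear[OF assms]])

lemma bilinear_comp_linear:
  assumes "bilinear b" "linear L"
  shows "bilinear (\<lambda>x y. L (b x y))"
  using assms by (simp add: bilinear_def linear_iff)

text \<open>Both sides are linear in \<open>t\<close> and agree on pure tensors. With
  \<open>t = \<Delta> x\<close> this moves a linear map under the Sweedler sum, the basic
  computation below.\<close>

lemma linear_comp_tlift2:
  assumes "bilinear b" "linear L"
  shows "L (tlift2 b t) = tlift2 (\<lambda>x y. L (b x y)) t"
proof -
  note b = bilinear_comp_linear[OF assms]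
  have "(\<lambda>t. L (tlift2 b t)) = tlift2 (\<lambda>x y. L (b x y))"
  proof (rule tensor_linear_eqI)
    show "linear (\<lambda>t. L (tlift2 b t))"
      using linear_compose[OF linear_tlift2[OF assms(1)] assms(2)] by (simp add: o_def)
    show "linear (tlift2 (\<lambda>x y. L (b x y)))"
      by (rule linear_tlift2[OF b])
    show "L (tlift2 b (pure xs)) = tlift2 (\<lambda>x y. L (b x y)) (pure xs)" for xs
      unfolding tlift2_pure_case[OF b] tlift2_pure_case[OF assms(1)]
      by (auto split: list.split simp: linear_0[OF assms(2)])
  qed
  then show ?thesis by (rule fun_cong)
qed

lemma tlift2_cong_on_span:
  assumes "t \<in> span A" "bilinear b" "linear L"
    and "\<And>s. s \<in> A \<Longrightarrow> tlift2 b s = L s"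
  shows "tlift2 b t = L t"
  using linear_eq_on_span[OF linear_tlift2[OF assms(2)] assms(3) assms(4) assms(1)] .

lemma linear_pure_slot: "linear (\<lambda>a. pure (us @ a # vs))"
  using multilinear_pure by (intro linearI) (auto simp: multilinear_def)

lemma linear_tconcat_left: "linear (\<lambda>s. tconcat s t)"
  and linear_tconcat_right: "linear (tconcat s)"
  using bilinear_tconcat by (auto simp: bilinear_def)

lemma tconcat_pure_Nil [simp]: "tconcat t (pure []) = t"
proof -
  have "(\<lambda>t. tconcat t (pure [])) = (\<lambda>t. t)"
    by (rule tensor_linear_eqI) (simp_all add: linear_tconcat_left tconcat_pure linear_ident)
  then show ?thesis by (rule fun_cong)
qed

section \<open>The coproduct on the first tensor factor\<close>

lemma multilinear_comult_first:
  assumes "linear \<Delta>"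
  shows "multilinear (\<lambda>xs. case xs of [] \<Rightarrow> 0 | x # ys \<Rightarrow> tconcat (\<Delta> x) (pure ys))"
proof (rule multilinear_nth_linear)
  fix us vs :: "'a list"
  show "linear (\<lambda>a. case us @ a # vs of [] \<Rightarrow> 0 | x # ys \<Rightarrow> tconcat (\<Delta> x) (pure ys))"
  proof (cases us)
    case Nil
    then show ?thesis
      using linear_compose[OF assms linear_tconcat_left] by (simp add: o_def)
  next
    case (Cons u us')
    then show ?thesis
      using linear_compose[OF linear_pure_slot linear_tconcat_right] by (simp add: o_def)
  qed
qed

lemma linear_comult_first: "linear \<Delta> \<Longrightarrow> linear (comult_first \<Delta>)"
  unfolding comult_first_def by (intro linear_tlift multilinear_comult_first)

lemma comult_first_pure_Cons:
  "linear \<Delta> \<Longrightarrow> comult_first \<Delta> (pure (x # xs)) = tconcat (\<Delta> x) (pure xs)"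
  unfolding comult_first_def by (simp add: tlift_pure[OF multilinear_comult_first])

lemma tconcat_assoc_pure:
  "tconcat (tconcat t (pure xs)) (pure ys) = tconcat t (pure (xs @ ys))"
proof -
  have "(\<lambda>t. tconcat (tconcat t (pure xs)) (pure ys)) = (\<lambda>t. tconcat t (pure (xs @ ys)))"
    using linear_compose[OF linear_tconcat_left linear_tconcat_left]
    by (intro tensor_linear_eqI) (simp_all add: linear_tconcat_left tconcat_pure o_def)
  then show ?thesis by (rule fun_cong)
qed

text \<open>Appended factors are untouched as long as \<open>t\<close> has a first factor. The span
  condition excludes \<open>pure []\<close>, which \<open>comult_first\<close> sends to 0 although
  \<open>pure ys\<close> may have a nonzero image.\<close>

lemma comult_first_tconcat:
  assumes "linear \<Delta>" "t \<in> span {pure (x # xs) | x xs. True}"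
  shows "comult_first \<Delta> (tconcat t (pure ys)) = tconcat (comult_first \<Delta> t) (pure ys)"
proof (rule linear_eq_on_span[OF _ _ _ assms(2)])
  show "linear (\<lambda>t. comult_first \<Delta> (tconcat t (pure ys)))"
    using linear_compose[OF linear_tconcat_left linear_comult_first[OF assms(1)]]
    by (simp add: o_def)
  show "linear (\<lambda>t. tconcat (comult_first \<Delta> t) (pure ys))"
    using linear_compose[OF linear_comult_first[OF assms(1)] linear_tconcat_left]
    by (simp add: o_def)
qed (auto simp: comult_first_pure_Cons[OF assms(1)] tconcat_pure tconcat_assoc_pure)

lemma bilinear_tconcat_single:
  assumes "linear f"
  shows "bilinear (\<lambda>a b. tconcat (f a) (pure [b]))"
proof -
  have "linear (\<lambda>b. pure [b])"
    using linear_pure_slot[of "[]" "[]"] by simp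
  then show ?thesis
    using linear_compose[OF assms linear_tconcat_left]
      linear_compose[OF _ linear_tconcat_right]
    by (auto simp: bilinear_def o_def)
qed

lemma linear_iter_comult:
  assumes "linear \<Delta>"
  shows "linear (iter_comult \<Delta> r)"
proof (induction r)
  case 0
  then show ?case
    using linear_pure_slot[of "[]" "[]"] by (simp add: iter_comult_def)
next
  case (Suc r)
  have "iter_comult \<Delta> (Suc r) = comult_first \<Delta> \<circ> iter_comult \<Delta> r"
    by (auto simp: iter_comult_def)
  then show ?case
    using Suc linear_compose linear_comult_first[OF assms] by metis
qed

lemma tlift2_add:
  assumes "bilinear b" "bilinear c"
  shows "tlift2 (\<lambda>x y. b x y + c x y) t = tlift2 b t + tlift2 c t"
proof -
  have bc: "bilinear (\<lambda>x y. b x y + c x y)"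
    using assms by (simp add: bilinear_def linear_compose_add)
  have "tlift2 (\<lambda>x y. b x y + c x y) = (\<lambda>t. tlift2 b t + tlift2 c t)"
    by (rule tensor_linear_eqI)
      (auto simp: linear_tlift2 bc assms tlift2_pure_case linear_compose_add split: list.split)
  then show ?thesis by (rule fun_cong)
qed

lemma tlift2_scaleR:
  assumes "bilinear b"
  shows "tlift2 (\<lambda>x y. r *\<^sub>R b x y) t = r *\<^sub>R tlift2 b t"
  using linear_comp_tlift2[OF assms, of "\<lambda>z. r *\<^sub>R z" t] by (simp add: linear_iff algebra_simps)

lemma bilinear_functional_scaleR:
  assumes "linear (f :: 'a::real_vector \<Rightarrow> real)"
  shows "bilinear (\<lambda>a b :: 'b::real_vector. f a *\<^sub>R b)"
  using assms by (simp add: bilinear_def linear_iff algebra_simps)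

lemma bilinear_functional_mult:
  assumes "linear (f :: 'a::real_vector \<Rightarrow> real)" "linear (g :: 'b::real_vector \<Rightarrow> real)"
  shows "bilinear (\<lambda>a b. f a * g b)"
  using assms by (simp add: bilinear_def linear_iff algebra_simps)

lemma linear_mult_right: "linear g \<Longrightarrow> linear (\<lambda>z. (c :: 'a::real_algebra) * g z)"
  and linear_mult_left: "linear g \<Longrightarrow> linear (\<lambda>z. g z * (c :: 'a::real_algebra))"
  by (simp_all add: linear_iff algebra_simps)

section \<open>Graded connected Hopf algebras\<close>

lemma graded_decompI:
  assumes "\<And>m. f m \<in> H m" "finite A" "{m. f m \<noteq> 0} \<subseteq> A" "x = sum f A"
  shows "graded_decomp H x f"
  unfolding graded_decomp_def
proof (intro conjI)
  show "finite {m. f m \<noteq> 0}" using assms finite_subset by blast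
  show "x = (\<Sum>m | f m \<noteq> 0. f m)"
    unfolding assms(4) by (rule sum.mono_neutral_right) (use assms in auto)
qed (use assms in auto)

lemma linear_tensor_mult: "linear tensor_mult"
  unfolding tensor_mult_def by (rule linear_tlift[OF multilinear_prod_list])

context graded_connected_hopf_algebra
begin

section \<open>Homogeneous components\<close>

lemma graded_decomp_component: "graded_decomp H x (\<lambda>m. component H m x)"
  unfolding component_def using theI'[OF direct_sum] by simp

lemma component_eqI: "graded_decomp H x f \<Longrightarrow> component H m x = f m"
  using direct_sum[of x] graded_decomp_component[of x] by metis

lemma component_in_H: "component H m x \<in> H m"
  using graded_decomp_component by (simp add: graded_decomp_def)

lemma component_homogeneous:
  assumes "x \<in> H i"
  shows "component H m x = (if m = i then x else 0)"
proof (rule component_eqI)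
  show "graded_decomp H x (\<lambda>m. if m = i then x else 0)"
    by (rule graded_decompI[of _ _ "{i}"]) (use assms subspace_0[OF subspace_H] in auto)
qed

lemma finite_component_support: "finite {m. component H m x \<noteq> 0}"
  using graded_decomp_component by (simp add: graded_decomp_def)

lemma sum_component:
  assumes "finite A" "{m. component H m x \<noteq> 0} \<subseteq> A"
  shows "(\<Sum>m\<in>A. component H m x) = x"
proof -
  have "(\<Sum>m\<in>A. component H m x) = (\<Sum>m | component H m x \<noteq> 0. component H m x)"
    by (rule sum.mono_neutral_right) (use assms in auto)
  then show ?thesis using graded_decomp_component[of x] by (simp add: graded_decomp_def)
qed

text \<open>Homogeneous decompositions are unique, and sums and multiples of decompositions are
  again decompositions.\<close>

lemma linear_component: "linear (component H m)"
proof (rule linearI)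
  fix x y c
  let ?A = "{m. component H m x \<noteq> 0} \<union> {m. component H m y \<noteq> 0}"
  have A: "finite ?A" by (simp add: finite_component_support)
  show "component H m (x + y) = component H m x + component H m y"
    by (rule component_eqI, rule graded_decompI[of _ _ ?A])
      (auto simp: sum.distrib sum_component[OF A] finite_component_support
        subspace_add[OF subspace_H] component_in_H)
  show "component H m (c *\<^sub>R x) = c *\<^sub>R component H m x"
    by (rule component_eqI, rule graded_decompI[of _ _ ?A])
      (auto simp: scaleR_sum_right[symmetric] sum_component[OF A] finite_component_support
        subspace_scale[OF subspace_H] component_in_H)
qed

lemma linear_eq_on_homogeneous:
  assumes "linear f" "linear g" "\<And>m x. x \<in> H m \<Longrightarrow> f x = g x"
  shows "f x = g x"
proof -
  have "f (\<Sum>m | component H m x \<noteq> 0. component H m x) =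
      g (\<Sum>m | component H m x \<noteq> 0. component H m x)"
    by (simp add: linear_sum assms(1,2) assms(3)[OF component_in_H])
  then show ?thesis
    by (simp add: sum_component finite_component_support)
qed

lemma one_in_H0: "1 \<in> H 0"
  by (simp add: connected span_base)

lemma H0E:
  assumes "x \<in> H 0"
  shows "x = \<epsilon> x *\<^sub>R 1"
  using assms by (auto simp: connected span_singleton linear_cmul[OF counit_linear] counit_one)

text \<open>Connectedness gives the claim in degree 0, and both sides vanish in positive degree. It
  evaluates the part 0 of \<open>top_parts\<close>.\<close>

lemma component_0: "component H 0 x = \<epsilon> x *\<^sub>R 1"
proof (rule linear_eq_on_homogeneous[OF linear_component])
  show "linear (\<lambda>x. \<epsilon> x *\<^sub>R (1::'h))"
    using counit_linear by (simp add: linear_iff algebra_simps)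
  show "component H 0 x = \<epsilon> x *\<^sub>R 1" if "x \<in> H m" for m x
    using that H0E[of x] counit_graded[of x m] by (cases "m = 0") (auto simp: component_homogeneous)
qed

section \<open>Iterated coproducts\<close>

lemma comult_in_tensor_square: "\<Delta> x \<in> span {pure [a, b] | a b. True}"
proof -
  \<comment> \<open>The grading axiom speaks of homogeneous elements only, so \<open>x\<close> is
    first split into its components.\<close>
  have "\<Delta> x = (\<Sum>m | component H m x \<noteq> 0. \<Delta> (component H m x))"
    using sum_component[OF finite_component_support subset_refl, of x]
    by (metis (no_types, lifting) linear_sum[OF comult_linear] sum.cong)
  also have "\<dots> \<in> span {pure [a, b] | a b. True}"
  proof (rule span_sum)
    fix m
    show "\<Delta> (component H m x) \<in> span {pure [a, b] | a b. True}"
      using comult_graded[OF component_in_H, of m x]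
      by (rule rev_subsetD) (rule span_mono, blast)
  qed
  finally show ?thesis .
qed

text \<open>Each application of \<Delta> replaces the first factor by two, so the empty tensor never
  occurs; this is what \<open>comult_first_tconcat\<close> asks for.\<close>

lemma iter_comult_in_positive_powers:
  "iter_comult \<Delta> r x \<in> span {pure (x # xs) | x xs. True}"
proof (induction r)
  case 0
  then show ?case by (auto simp: iter_comult_def intro: span_base)
next
  case (Suc r)
  let ?N = "span {pure (x # xs) | x xs. True}"
  have conc: "tconcat t (pure ys) \<in> ?N" if "t \<in> span {pure [a, b] | a b. True}" for t and ys :: "'h list"
  proof -
    have "(\<lambda>t. tconcat t (pure ys)) t \<in> (\<lambda>t. tconcat t (pure ys)) ` span {pure [a, b] | a b. True}"
      using that by blast
    also have "\<dots> = span ((\<lambda>t. tconcat t (pure ys)) ` {pure [a, b] | a b. True})"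
      by (rule linear_span_image[OF linear_tconcat_left, symmetric])
    also have "\<dots> \<subseteq> ?N"
      by (rule span_mono) (fastforce simp: tconcat_pure)
    finally show ?thesis .
  qed
  have "comult_first \<Delta> ` ?N \<subseteq> ?N"
    unfolding linear_span_image[OF linear_comult_first[OF comult_linear], symmetric]
  proof (intro span_minimal subspace_span subsetI)
    fix t assume "t \<in> comult_first \<Delta> ` {pure (x # xs) | x xs. True}"
    then obtain x xs where "t = tconcat (\<Delta> x) (pure xs)"
      by (auto simp: comult_first_pure_Cons[OF comult_linear])
    then show "t \<in> ?N"
      using conc[OF comult_in_tensor_square] by blast
  qed
  then show ?case
    using Suc by (auto simp: iter_comult_def)
qed

text \<open>The definition peels off the last application of \<Delta>; here the first one is peeled
  off. The later ones act on its left factor \<open>a\<close> only, so \<open>b\<close> stays at the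
  end.\<close>

lemma iter_comult_Suc:
  "iter_comult \<Delta> (Suc r) x = tlift2 (\<lambda>a b. tconcat (iter_comult \<Delta> r a) (pure [b])) (\<Delta> x)"
proof (induction r)
  case 0
  have b: "bilinear (\<lambda>a b. tconcat (iter_comult \<Delta> 0 a) (pure [b]))"
    by (intro bilinear_tconcat_single linear_iter_comult comult_linear)
  have "tlift2 (\<lambda>a b. tconcat (iter_comult \<Delta> 0 a) (pure [b])) (\<Delta> x) = \<Delta> x"
    by (rule tlift2_cong_on_span[OF comult_in_tensor_square b linear_ident])
      (auto simp: tlift2_pure[OF b], simp add: iter_comult_def tconcat_pure)
  then show ?case
    by (simp add: iter_comult_def comult_first_pure_Cons[OF comult_linear])
next
  case (Suc r)
  have b: "bilinear (\<lambda>a b. tconcat (iter_comult \<Delta> r a) (pure [b]))"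
    by (intro bilinear_tconcat_single linear_iter_comult comult_linear)
  have "iter_comult \<Delta> (Suc (Suc r)) x = comult_first \<Delta> (iter_comult \<Delta> (Suc r) x)"
    by (simp add: iter_comult_def)
  also have "\<dots> = tlift2 (\<lambda>a b. comult_first \<Delta> (tconcat (iter_comult \<Delta> r a) (pure [b]))) (\<Delta> x)"
    unfolding Suc by (rule linear_comp_tlift2[OF b linear_comult_first[OF comult_linear]])
  also have "\<dots> = tlift2 (\<lambda>a b. tconcat (iter_comult \<Delta> (Suc r) a) (pure [b])) (\<Delta> x)"
    unfolding comult_first_tconcat[OF comult_linear iter_comult_in_positive_powers]
    by (simp add: iter_comult_def)
  finally show ?case .
qed

section \<open>Projection to a multidegree followed by multiplication\<close>

lemma multilinear_tensor_component:
  "multilinear (\<lambda>xs. if length xs = length ds then pure (map2 (component H) ds xs) else 0)"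
proof (rule multilinear_nth_linear)
  fix us vs :: "'h list"
  show "linear (\<lambda>a. if length (us @ a # vs) = length ds
      then pure (map2 (component H) ds (us @ a # vs)) else 0)"
  proof (cases "length ds = length us + Suc (length vs)")
    case True
    then obtain es d fs where ds: "ds = es @ d # fs" "length es = length us"
      using id_take_nth_drop[of "length us" ds] by force
    have "linear (\<lambda>a. pure (map2 (component H) es us @ component H d a # map2 (component H) fs vs))"
      using linear_compose[OF linear_component linear_pure_slot] by (simp add: o_def)
    then show ?thesis using True by (simp add: ds)
  next
    case False
    then show ?thesis by (simp add: linear_zero)
  qed
qed

lemma linear_tensor_component: "linear (tensor_component H ds)"
  unfolding tensor_component_def by (rule linear_tlift[OF multilinear_tensor_component])

lemma tensor_component_pure:
  "tensor_component H ds (pure xs) =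
     (if length xs = length ds then pure (map2 (component H) ds xs) else 0)"
  unfolding tensor_component_def by (rule tlift_pure[OF multilinear_tensor_component])

text \<open>If the lengths match, the last pair splits off the product; otherwise both sides are
  0.\<close>

lemma tensor_mult_component_tconcat:
  "tensor_mult (tensor_component H (ds @ [d]) (tconcat t (pure [b]))) =
     tensor_mult (tensor_component H ds t) * component H d b"
proof -
  have "(\<lambda>t. tensor_mult (tensor_component H (ds @ [d]) (tconcat t (pure [b])))) =
      (\<lambda>t. tensor_mult (tensor_component H ds t) * component H d b)"
  proof (rule tensor_linear_eqI)
    show "linear (\<lambda>t. tensor_mult (tensor_component H (ds @ [d]) (tconcat t (pure [b]))))"
      using linear_compose[OF linear_tconcat_left
          linear_compose[OF linear_tensor_component linear_tensor_mult]]
      by (simp add: o_def)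
    show "linear (\<lambda>t. tensor_mult (tensor_component H ds t) * component H d b)"
      using linear_compose[OF linear_tensor_component linear_tensor_mult]
      by (simp add: o_def linear_iff algebra_simps)
  qed (simp add: tconcat_pure tensor_component_pure tensor_mult_pure linear_0[OF linear_tensor_mult])
  then show ?thesis by (rule fun_cong)
qed

lemma tensor_mult_comult_parts_singleton:
  "tensor_mult (comult_parts H \<Delta> [d] x) = component H d x"
  by (simp add: comult_parts_def iter_comult_def tensor_component_pure tensor_mult_pure)

text \<open>A recursion on the last part, obtained from \<open>iter_comult_Suc\<close>. For nonempty
  \<open>ds\<close> the number \<open>length ds\<close> of coproducts is a successor, as that rule
  demands.\<close>

lemma tensor_mult_comult_parts_snoc:
  assumes "ds \<noteq> []"
  shows "tensor_mult (comult_parts H \<Delta> (ds @ [d]) x) =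
    tlift2 (\<lambda>a b. tensor_mult (comult_parts H \<Delta> ds a) * component H d b) (\<Delta> x)"
proof -
  obtain r where r: "length ds = Suc r" using assms by (cases ds) auto
  have b: "bilinear (\<lambda>a b. tconcat (iter_comult \<Delta> r a) (pure [b]))"
    by (intro bilinear_tconcat_single linear_iter_comult comult_linear)
  have "linear (\<lambda>t. tensor_mult (tensor_component H (ds @ [d]) t))"
    using linear_compose[OF linear_tensor_component linear_tensor_mult] by (simp add: o_def)
  from linear_comp_tlift2[OF b this]
  show ?thesis
    by (simp add: comult_parts_def r iter_comult_Suc tensor_mult_component_tconcat)
qed

section \<open>The convolution product of functionals and its right action on the algebra\<close>

definition act :: "('h \<Rightarrow> real) \<Rightarrow> 'h \<Rightarrow> 'h" where
  "act f x = tlift2 (\<lambda>a b. f a *\<^sub>R b) (\<Delta> x)"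

definition conv :: "('h \<Rightarrow> real) \<Rightarrow> ('h \<Rightarrow> real) \<Rightarrow> 'h \<Rightarrow> real" where
  "conv f g x = tlift2 (\<lambda>a b. f a * g b) (\<Delta> x)"

lemma linear_act: "linear f \<Longrightarrow> linear (act f)"
  using linear_compose[OF comult_linear linear_tlift2[OF bilinear_functional_scaleR]]
  by (simp add: act_def[abs_def] o_def)

lemma linear_conv: "linear f \<Longrightarrow> linear g \<Longrightarrow> linear (conv f g)"
  using linear_compose[OF comult_linear linear_tlift2[OF bilinear_functional_mult]]
  by (simp add: conv_def[abs_def] o_def)

lemma act_counit: "act \<epsilon> x = x"
  by (simp add: act_def counit_left)

text \<open>Coassociativity, with \<open>f \<otimes> g \<otimes> id\<close> evaluated on its two
  sides. The reversed order makes \<open>act\<close> a right action.\<close>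

lemma act_conv:
  assumes f: "linear f" and g: "linear g"
  shows "act (conv f g) x = act g (act f x)"
proof -
  \<comment> \<open>This is \<open>f \<otimes> g \<otimes> id\<close> on the third tensor power,
    extended by 0 to the others.\<close>
  let ?l = "\<lambda>xs. case xs of [a, b, c] \<Rightarrow> (f a * g b) *\<^sub>R c | _ \<Rightarrow> (0 :: 'h)"
  define L where "L = tlift ?l"
  have ml: "multilinear ?l"
  proof (rule multilinear_nth_linear)
    fix us vs :: "'h list"
    have lin: "linear (\<lambda>a. (f a * g b) *\<^sub>R c)" "linear (\<lambda>b. (f a * g b) *\<^sub>R c)"
      "linear (\<lambda>c. (f a * g b) *\<^sub>R c)" for a b and c :: 'h
      using f g by (simp_all add: linear_iff algebra_simps)
    have zero: "?l xs = 0" if "length xs \<noteq> 3" for xs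
      using that by (auto split: list.split)
    consider "length us + length vs \<noteq> 2"
      | b c where "us = []" "vs = [b, c]" | a c where "us = [a]" "vs = [c]"
      | a b where "us = [a, b]" "vs = []"
    proof (cases "length us + length vs = 2")
      case True
      then consider "length us = 0" "length vs = 2" | "length us = 1" "length vs = 1"
        | "length us = 2" "length vs = 0" by linarith
      then show ?thesis
        by cases (auto simp: length_Suc_conv numeral_2_eq_2 intro: that)
    qed (use that in blast)
    then show "linear (\<lambda>a. ?l (us @ a # vs))"
    proof cases
      case 1
      then show ?thesis by (subst zero) (auto simp: linear_zero)
    qed (simp_all add: lin)
  qed
  note L = linear_tlift[OF ml, folded L_def] tlift_pure[OF ml, folded L_def]
  have bconv: "bilinear (\<lambda>a b. f a * g b)" and bact: "bilinear (\<lambda>a b. g a *\<^sub>R (b :: 'h))"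
    and bf: "bilinear (\<lambda>a b. f a *\<^sub>R (b :: 'h))"
    using f g by (auto intro: bilinear_functional_scaleR bilinear_functional_mult)
  have left: "L (tconcat s (pure [b])) = tlift2 (\<lambda>x y. f x * g y) s *\<^sub>R b" for s b
  proof -
    have "(\<lambda>s. L (tconcat s (pure [b]))) = (\<lambda>s. tlift2 (\<lambda>x y. f x * g y) s *\<^sub>R b)"
    proof (rule tensor_linear_eqI)
      show "linear (\<lambda>s. L (tconcat s (pure [b])))"
        using linear_compose[OF linear_tconcat_left L(1)] by (simp add: o_def)
      show "linear (\<lambda>s. tlift2 (\<lambda>x y. f x * g y) s *\<^sub>R b)"
        using linear_tlift2[OF bconv] by (simp add: linear_iff algebra_simps)
    qed (auto simp: tconcat_pure L(2) tlift2_pure_case[OF bconv] split: list.split)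
    then show ?thesis by (rule fun_cong)
  qed
  have right: "L (tconcat (pure [a]) s) = f a *\<^sub>R tlift2 (\<lambda>x y. g x *\<^sub>R y) s" for s a
  proof -
    have "(\<lambda>s. L (tconcat (pure [a]) s)) = (\<lambda>s. f a *\<^sub>R tlift2 (\<lambda>x y. g x *\<^sub>R y) s)"
    proof (rule tensor_linear_eqI)
      show "linear (\<lambda>s. L (tconcat (pure [a]) s))"
        using linear_compose[OF linear_tconcat_right L(1)] by (simp add: o_def)
      show "linear (\<lambda>s. f a *\<^sub>R tlift2 (\<lambda>x y. g x *\<^sub>R (y::'h)) s)"
        using linear_tlift2[OF bact] by (simp add: linear_iff algebra_simps)
    qed (auto simp: tconcat_pure L(2) tlift2_pure_case[OF bact] split: list.split)
    then show ?thesis by (rule fun_cong)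
  qed
  have b2: "bilinear (\<lambda>a b. tconcat (pure [a]) (\<Delta> b))"
    using linear_compose[OF comult_linear linear_tconcat_right]
      linear_compose[OF linear_pure_slot[of "[]" "[]"] linear_tconcat_left]
    by (auto simp: bilinear_def o_def)
  have "act (conv f g) x = L (tlift2 (\<lambda>a b. tconcat (\<Delta> a) (pure [b])) (\<Delta> x))"
    unfolding linear_comp_tlift2[OF bilinear_tconcat_single[OF comult_linear] L(1)] left
    by (simp add: act_def conv_def)
  also have "\<dots> = tlift2 (\<lambda>a b. f a *\<^sub>R act g b) (\<Delta> x)"
    unfolding coassoc linear_comp_tlift2[OF b2 L(1)] right by (simp add: act_def)
  also have "\<dots> = act g (act f x)"
    unfolding act_def[of f] linear_comp_tlift2[OF bf linear_act[OF g]]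
    by (simp add: linear_cmul[OF linear_act[OF g]])
  finally show ?thesis .
qed

text \<open>Since \<Delta> is multiplicative, \<open>f\<close> meets products \<open>a * c\<close>
  of left factors. In each of the two terms of its value one functional is \<epsilon>, and the
  counit law contracts that coproduct.\<close>

lemma act_mult:
  assumes f: "linear f" and der: "\<And>a c. f (a * c) = f a * \<epsilon> c + \<epsilon> a * f c"
  shows "act f (x * y) = act f x * y + x * act f y"
proof -
  note bf = bilinear_functional_scaleR[OF f] and be = bilinear_functional_scaleR[OF counit_linear]
  have bp: "bilinear (\<lambda>c d. pure [a * c, b * d])" for a b :: 'h
    using linear_compose[OF linear_mult_right[OF linear_ident, of a] linear_pure_slot[of "[]" "[_]"]]
      linear_compose[OF linear_mult_right[OF linear_ident, of b] linear_pure_slot[of "[_]" "[]"]]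
    by (simp add: bilinear_def o_def)
  have bo: "bilinear (\<lambda>a b. tlift2 (\<lambda>c d. pure [a * c, b * d]) t)" for t :: "'h tensor"
  proof -
    have "pure [(a + a') * c, b] = pure [a * c, b] + pure [a' * c, b]"
      "pure [b, (a + a') * c] = pure [b, a * c] + pure [b, a' * c]"
      "pure [(r *\<^sub>R a) * c, b] = r *\<^sub>R pure [a * c, b]"
      "pure [b, (r *\<^sub>R a) * c] = r *\<^sub>R pure [b, a * c]" for a a' b c :: 'h and r
      using linear_pure_slot[of "[]" "[b]"] linear_pure_slot[of "[b]" "[]"]
      by (auto simp: linear_iff algebra_simps)
    then show ?thesis
      by (simp add: bilinear_def linear_iff tlift2_add[OF bp bp] tlift2_scaleR[OF bp])
  qed
  \<comment> \<open>A pure tensor of \<open>a\<close> and \<open>b\<close> stands for \<Delta> x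
    while \<Delta> y is contracted.\<close>
  have inner: "tlift2 (\<lambda>a b. f a *\<^sub>R b) (tlift2 (\<lambda>c d. pure [a * c, b * d]) (\<Delta> y)) =
      (f a *\<^sub>R b) * y + (\<epsilon> a *\<^sub>R b) * act f y" for a b
  proof -
    let ?p = "\<lambda>z. (f a *\<^sub>R b) * z" and ?q = "\<lambda>z. (\<epsilon> a *\<^sub>R b) * z"
    have lp: "linear ?p" and lq: "linear ?q" by (rule linear_mult_right[OF linear_ident])+
    have "tlift2 (\<lambda>a b. f a *\<^sub>R b) (tlift2 (\<lambda>c d. pure [a * c, b * d]) (\<Delta> y)) =
        tlift2 (\<lambda>c d. f (a * c) *\<^sub>R (b * d)) (\<Delta> y)"
      unfolding linear_comp_tlift2[OF bp linear_tlift2[OF bf]] tlift2_pure[OF bf] ..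
    also have "\<dots> = tlift2 (\<lambda>c d. ?p (\<epsilon> c *\<^sub>R d) + ?q (f c *\<^sub>R d)) (\<Delta> y)"
      by (simp add: der algebra_simps)
    also have "\<dots> = ?p (act \<epsilon> y) + ?q (act f y)"
      unfolding tlift2_add[OF bilinear_comp_linear[OF be lp] bilinear_comp_linear[OF bf lq]]
      unfolding act_def linear_comp_tlift2[OF be lp] linear_comp_tlift2[OF bf lq] ..
    finally show ?thesis by (simp add: act_counit)
  qed
  let ?r = "\<lambda>z. z * y" and ?s = "\<lambda>z. z * act f y"
  have lr: "linear ?r" and ls: "linear ?s" by (rule linear_mult_left[OF linear_ident])+
  have "act f (x * y) = tlift2 (\<lambda>a b. ?r (f a *\<^sub>R b) + ?s (\<epsilon> a *\<^sub>R b)) (\<Delta> x)"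
    unfolding act_def[of f "x * y"] comult_mult tmult2_def
      linear_comp_tlift2[OF bo linear_tlift2[OF bf]] inner ..
  also have "\<dots> = ?r (act f x) + ?s (act \<epsilon> x)"
    unfolding tlift2_add[OF bilinear_comp_linear[OF bf lr] bilinear_comp_linear[OF be ls]]
    unfolding act_def[of _ x] linear_comp_tlift2[OF bf lr] linear_comp_tlift2[OF be ls] ..
  finally show ?thesis by (simp add: act_counit)
qed

end

section \<open>Strong lumping of finite Markov chains\<close>

lemma measurable_count_space_pred_eq:
  assumes "X \<in> measurable M (count_space \<Omega>)"
  shows "Measurable.pred M (\<lambda>w. X w = c)"
proof -
  \<comment> \<open>The state \<open>c\<close> may lie outside \<Omega>; then both sets are
    empty.\<close>
  have "{w \<in> space M. X w = c} = X -` ({c} \<inter> \<Omega>) \<inter> space M"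
    using measurable_space[OF assms] by auto
  then show ?thesis
    using measurable_sets[OF assms, of "{c} \<inter> \<Omega>"] by (simp add: pred_def)
qed

text \<open>The product form also covers histories of probability 0, where the Markov condition is
  silent and both sides vanish.\<close>

lemma markov_chain_joint_prob:
  assumes "markov_chain M \<Omega> K X" "\<And>i. i \<le> t \<Longrightarrow> s i \<in> \<Omega>" "y \<in> \<Omega>"
  shows "\<P>(w in M. X (Suc t) w = y \<and> (\<forall>i\<le>t. X i w = s i)) =
    \<P>(w in M. \<forall>i\<le>t. X i w = s i) * K (s t) y"
proof -
  interpret prob_space M using assms by (simp add: markov_chain_def)
  have [measurable]: "Measurable.pred M (\<lambda>w. X i w = c)" for i c
    using assms by (auto simp: markov_chain_def intro: measurable_count_space_pred_eq)
  \<comment> \<open>The Markov condition is stated for one path through time \<open>Suc t\<close>,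
    so the next state \<open>y\<close> is appended to \<open>s\<close>.\<close>
  let ?s = "s(Suc t := y)"
  have s: "(\<forall>i\<le>t. X i w = ?s i) \<longleftrightarrow> (\<forall>i\<le>t. X i w = s i)" for w by auto
  show ?thesis
  proof (cases "\<P>(w in M. \<forall>i\<le>t. X i w = s i) = 0")
    case True
    have "\<P>(w in M. X (Suc t) w = y \<and> (\<forall>i\<le>t. X i w = s i)) \<le> \<P>(w in M. \<forall>i\<le>t. X i w = s i)"
      by (rule finite_measure_mono) auto
    then show ?thesis using True by (simp add: measure_le_0_iff)
  next
    case False
    have "\<forall>i\<le>Suc t. ?s i \<in> \<Omega>" using assms by (auto simp: le_Suc_eq)
    moreover have "\<P>(w in M. \<forall>i\<le>t. X i w = ?s i) \<noteq> 0"
      using False unfolding s .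
    ultimately have "\<P>(w in M. X (Suc t) w = ?s (Suc t) \<bar> \<forall>i\<le>t. X i w = ?s i) =
        K (?s t) (?s (Suc t))"
      using assms(1) unfolding markov_chain_def by blast
    then have "\<P>(w in M. X (Suc t) w = y \<bar> \<forall>i\<le>t. X i w = s i) = K (s t) y"
      unfolding s by simp
    then show ?thesis
      using False by (simp add: cond_prob_def field_simps)
  qed
qed

text \<open>Strong lumpability: the probability of entering a fibre depends on the current state
  only through its fibre. Summing over all histories in the fibres gives the Markov property of the
  image; \<open>K'\<close> is stochastic because \<open>K\<close> is and \<theta> is onto.\<close>

lemma lumps_viaI:
  assumes K: "transition_matrix \<Omega> K" and onto: "\<theta> ` \<Omega> = \<Omega>'"
    and lump: "\<And>x z. x \<in> \<Omega> \<Longrightarrow> z \<in> \<Omega>' \<Longrightarrow> (\<Sum>y | y \<in> \<Omega> \<and> \<theta> y = z. K x y) = K' (\<theta> x) z"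
  shows "lumps_via M \<Omega> K \<theta> \<Omega>' K'"
proof -
  have fin: "finite \<Omega>" "finite \<Omega>'" using K onto by (auto simp: transition_matrix_def)
  have K': "transition_matrix \<Omega>' K'"
    unfolding transition_matrix_def
  proof (intro conjI ballI)
    fix z assume "z \<in> \<Omega>'"
    then obtain x where x: "x \<in> \<Omega>" "z = \<theta> x" using onto by auto
    show "0 \<le> K' z z'" if "z' \<in> \<Omega>'" for z'
      unfolding x(2) lump[OF x(1) that, symmetric]
      using K x by (intro sum_nonneg) (auto simp: transition_matrix_def)
    have "(\<Sum>z'\<in>\<Omega>'. K' z z') = (\<Sum>z'\<in>\<Omega>'. \<Sum>y | y \<in> \<Omega> \<and> \<theta> y = z'. K x y)"
      using x lump by simp
    also have "\<dots> = (\<Sum>y\<in>\<Omega>. K x y)"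
      using sum.group[OF fin, of \<theta> "K x"] onto by simp
    finally show "(\<Sum>z'\<in>\<Omega>'. K' z z') = 1" using K x by (simp add: transition_matrix_def)
  qed (use fin in auto)
  have "markov_chain M \<Omega>' K' (\<lambda>t w. \<theta> (X t w))" if X: "markov_chain M \<Omega> K X" for X
  proof -
    interpret prob_space M using X by (simp add: markov_chain_def)
    have X_meas: "X i \<in> measurable M (count_space \<Omega>)" for i
      using X by (simp add: markov_chain_def)
    have [measurable]: "Measurable.pred M (\<lambda>w. X i w = c)" for i c
      by (rule measurable_count_space_pred_eq[OF X_meas])
    have X_in: "X i w \<in> \<Omega>" if "w \<in> space M" for i w
      using measurable_space[OF X_meas that] by simp
    have "(\<lambda>w. \<theta> (X t w)) \<in> measurable M (count_space \<Omega>')" for t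
      using measurable_compose[OF X_meas, of \<theta> "count_space \<Omega>'"] onto by auto
    moreover have "\<P>(w in M. \<theta> (X (Suc t) w) = s (Suc t) \<bar> \<forall>i\<le>t. \<theta> (X i w) = s i) =
        K' (s t) (s (Suc t))"
      if s: "\<forall>i\<le>Suc t. s i \<in> \<Omega>'" and nz: "\<P>(w in M. \<forall>i\<le>t. \<theta> (X i w) = s i) \<noteq> 0" for t s
    proof -
      \<comment> \<open>\<open>P\<close> lists the paths above \<open>s\<close> up to time
        \<open>t\<close>; extensionality makes it finite and gives each path one
        representative.\<close>
      define P where "P = (\<Pi>\<^sub>E i\<in>{..t}. {x \<in> \<Omega>. \<theta> x = s i})"
      define Q where "Q = {y \<in> \<Omega>. \<theta> y = s (Suc t)}"
      have finPQ: "finite P" "finite Q"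
        using fin by (auto simp: P_def Q_def intro!: finite_PiE)
      have P_in: "p i \<in> \<Omega>" "\<theta> (p i) = s i" if "p \<in> P" "i \<le> t" for p i
        using that by (auto simp: P_def PiE_iff)
      have P_eq: "p = p'" if "p \<in> P" "p' \<in> P" "\<And>i. i \<le> t \<Longrightarrow> p i = p' i" for p p'
        using that unfolding P_def by (intro PiE_ext) auto
      have P_restrict: "(\<lambda>i\<in>{..t}. X i w) \<in> P" if "w \<in> space M" "\<forall>i\<le>t. \<theta> (X i w) = s i" for w
        using that X_in by (auto simp: P_def)
      define E where "E p = {w \<in> space M. \<forall>i\<le>t. X i w = p i}" for p
      define G where "G = (\<lambda>(p, y). {w \<in> space M. X (Suc t) w = y \<and> (\<forall>i\<le>t. X i w = p i)})"
      have sets: "E p \<in> events" "G (p, y) \<in> events" for p y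
        unfolding E_def G_def prod.case by measurable
      have "{w \<in> space M. \<forall>i\<le>t. \<theta> (X i w) = s i} = (\<Union>p\<in>P. E p)"
      proof (intro equalityI subsetI)
        fix w assume "w \<in> {w \<in> space M. \<forall>i\<le>t. \<theta> (X i w) = s i}"
        then show "w \<in> (\<Union>p\<in>P. E p)"
          using P_restrict[of w] by (intro UN_I[of "\<lambda>i\<in>{..t}. X i w"]) (auto simp: E_def)
      qed (auto simp: E_def P_in)
      moreover have "disjoint_family_on E P"
        by (auto simp: disjoint_family_on_def E_def) (metis P_eq)
      ultimately have F: "\<P>(w in M. \<forall>i\<le>t. \<theta> (X i w) = s i) = (\<Sum>p\<in>P. prob (E p))"
        using sets finPQ by (simp add: finite_measure_finite_Union image_subset_iff)
      have "{w \<in> space M. \<theta> (X (Suc t) w) = s (Suc t) \<and> (\<forall>i\<le>t. \<theta> (X i w) = s i)} =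
          (\<Union>py\<in>P \<times> Q. G py)"
      proof (intro equalityI subsetI)
        fix w assume "w \<in> {w \<in> space M. \<theta> (X (Suc t) w) = s (Suc t) \<and> (\<forall>i\<le>t. \<theta> (X i w) = s i)}"
        then show "w \<in> (\<Union>py\<in>P \<times> Q. G py)"
          using P_restrict[of w] X_in
          by (intro UN_I[of "(\<lambda>i\<in>{..t}. X i w, X (Suc t) w)"]) (auto simp: G_def Q_def)
      qed (auto simp: G_def Q_def P_in)
      moreover have "disjoint_family_on G (P \<times> Q)"
        by (auto simp: disjoint_family_on_def G_def) (metis P_eq)
      ultimately have "\<P>(w in M. \<theta> (X (Suc t) w) = s (Suc t) \<and> (\<forall>i\<le>t. \<theta> (X i w) = s i)) =
          (\<Sum>py\<in>P \<times> Q. prob (G py))"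
        using sets finPQ by (simp add: finite_measure_finite_Union image_subset_iff)
      also have "\<dots> = (\<Sum>p\<in>P. \<Sum>y\<in>Q. prob (E p) * K (p t) y)"
        unfolding sum.cartesian_product
        by (rule sum.cong)
          (auto simp: G_def E_def Q_def P_in intro!: markov_chain_joint_prob[OF X])
      \<comment> \<open>The inner sum is the row sum over the fibre of \<open>s (Suc t)\<close>, and
        \<open>lump\<close> applies since \<open>\<theta> (p t) = s t\<close>.\<close>
      also have "\<dots> = (\<Sum>p\<in>P. prob (E p) * K' (s t) (s (Suc t)))"
        using s by (intro sum.cong)
          (auto simp: sum_distrib_left[symmetric] Q_def P_in lump)
      also have "\<dots> = \<P>(w in M. \<forall>i\<le>t. \<theta> (X i w) = s i) * K' (s t) (s (Suc t))"
        by (simp add: F sum_distrib_right)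
      finally show ?thesis
        using nz by (simp add: cond_prob_def)
    qed
    ultimately show ?thesis
      unfolding markov_chain_def using K' prob_space_axioms by blast
  qed
  then show ?thesis using K K' onto by (simp add: lumps_via_def)
qed

section \<open>Bases with a single atom\<close>

text \<open>Basis elements go to basis elements, so coefficients add up along fibres. For
  \<open>L\<close> a power of \<open>der\<close> this turns operator identities into row sum
  conditions.\<close>

lemma representation_linear_image:
  assumes C: "independent C" "finite C" and C': "independent C'"
    and L: "linear L" "\<And>y. y \<in> C \<Longrightarrow> L y \<in> C'" and w: "w \<in> span C"
  shows "representation C' (L w) z = (\<Sum>y | y \<in> C \<and> L y = z. representation C w y)"
proof -
  have "L w = L (\<Sum>y\<in>C. representation C w y *\<^sub>R y)"
    using real_vector.sum_representation_eq[OF C(1) w C(2)] by simp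
  also have "\<dots> = (\<Sum>y\<in>C. representation C w y *\<^sub>R L y)"
    by (simp add: linear_sum[OF L(1)] linear_cmul[OF L(1)])
  finally have "representation C' (L w) z =
      (\<Sum>y\<in>C. representation C' (representation C w y *\<^sub>R L y) z)"
    using L(2) by (simp add: real_vector.representation_sum[OF C'] span_scale span_base)
  also have "\<dots> = (\<Sum>y\<in>C. if L y = z then representation C w y else 0)"
    using L(2)
    by (intro sum.cong)
      (auto simp: real_vector.representation_scale[OF C'] span_base
        real_vector.representation_basis[OF C'])
  also have "\<dots> = (\<Sum>y | y \<in> C \<and> L y = z. representation C w y)"
    using C(2) by (simp add: sum.If_cases Int_def)
  finally show ?thesis .
qed

locale single_atom_hopf_algebra = graded_connected_hopf_algebra H \<Delta> \<epsilon> S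
  for H :: "nat \<Rightarrow> 'h::real_algebra_1 set" and \<Delta> \<epsilon> S +
  fixes B :: "nat \<Rightarrow> 'h set" and pt :: 'h and D :: "'h \<Rightarrow> 'h"
  assumes graded_basis_B: "graded_basis H B"
    and B_1: "B 1 = {pt}"
    and D_in_B: "1 \<le> m \<Longrightarrow> x \<in> B m \<Longrightarrow> D x \<in> B (m - 1)"
    and comult_parts_eq: "1 \<le> m \<Longrightarrow> x \<in> B m \<Longrightarrow> comult_parts H \<Delta> [1, m - 1] x = pure [pt, D x]"
    and pt_mult_nonneg:
      "1 \<le> m \<Longrightarrow> z \<in> B (m - 1) \<Longrightarrow> y \<in> B m \<Longrightarrow> 0 \<le> representation (B m) (pt * z) y"
begin

section \<open>The basis and the coefficient of the atom\<close>

lemma independent_B: "independent (B m)"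
  and span_B: "span (B m) = H m"
  using graded_basis_B by (auto simp: graded_basis_def)

lemma B_in_H: "x \<in> B m \<Longrightarrow> x \<in> H m"
  using span_B span_base by blast

lemma finite_B: "finite (B m)"
proof -
  obtain F where "finite F" "span F = H m" using finite_dim_H by blast
  then show ?thesis
    using real_vector.independent_span_bound[OF _ independent_B, of F m] B_in_H by auto
qed

lemma pt_in_H1: "pt \<in> H 1"
  using B_in_H[of pt 1] B_1 by simp

text \<open>The functional \<pi> of the introduction. Projecting to degree 1 first keeps it linear,
  as \<open>representation\<close> is 0 outside the span of the basis.\<close>

definition atom_coeff :: "'h \<Rightarrow> real" where
  "atom_coeff a = representation (B 1) (component H 1 a) pt"

lemma linear_atom_coeff: "linear atom_coeff"
  using component_in_H[of 1]
  by (intro linearI)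
    (simp_all add: atom_coeff_def linear_add[OF linear_component] linear_cmul[OF linear_component]
      real_vector.representation_add[OF independent_B]
      real_vector.representation_scale[OF independent_B] span_B del: One_nat_def)

lemma atom_coeff_pt: "atom_coeff pt = 1"
  using pt_in_H1
    real_vector.representation_basis[OF independent_B[of 1], of pt]
  by (simp add: atom_coeff_def component_homogeneous B_1 del: One_nat_def)

lemma component_1: "component H 1 a = atom_coeff a *\<^sub>R pt"
proof -
  have "component H 1 a \<in> span {pt}"
    using component_in_H[of 1 a] span_B[of 1] B_1 by simp
  then obtain c where c: "component H 1 a = c *\<^sub>R pt"
    by (auto simp: span_singleton)
  have "representation (B 1) (c *\<^sub>R pt) pt = c"
    using independent_B[of 1]
    by (simp add: real_vector.representation_scale real_vector.representation_basis B_1 span_base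
        del: One_nat_def)
  then show ?thesis by (simp add: c atom_coeff_def del: One_nat_def)
qed

lemma atom_coeff_homogeneous: "x \<in> H m \<Longrightarrow> m \<noteq> 1 \<Longrightarrow> atom_coeff x = 0"
  by (simp add: atom_coeff_def component_homogeneous real_vector.representation_zero)

text \<open>By bilinearity both factors may be taken homogeneous. A factor of degree 0 is its counit
  times 1 and has no atom coefficient; two factors of positive degree have counit 0 and a product of
  degree at least 2.\<close>

lemma atom_coeff_mult: "atom_coeff (a * c) = atom_coeff a * \<epsilon> c + \<epsilon> a * atom_coeff c"
proof -
  have hom: "atom_coeff (a * c) = atom_coeff a * \<epsilon> c + \<epsilon> a * atom_coeff c"
    if a: "a \<in> H i" and c: "c \<in> H j" for a c i j
  proof -
    consider "i = 0" | "j = 0" | "i \<noteq> 0" "j \<noteq> 0" by blast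
    then show ?thesis
    proof cases
      case 1
      then have "a = \<epsilon> a *\<^sub>R 1" "atom_coeff a = 0"
        using a H0E atom_coeff_homogeneous by auto
      then show ?thesis
        by (metis add_0 linear_cmul[OF linear_atom_coeff] mult_zero_left mult_1 mult_scaleR_left
            real_scaleR_def)
    next
      case 2
      then have "c = \<epsilon> c *\<^sub>R 1" "atom_coeff c = 0"
        using c H0E atom_coeff_homogeneous by auto
      then show ?thesis
        by (metis add.right_neutral linear_cmul[OF linear_atom_coeff] mult_zero_right mult.right_neutral
            mult_scaleR_right real_scaleR_def mult.commute)
    next
      case 3
      then show ?thesis
        using atom_coeff_homogeneous[OF mult_graded[OF a c]] counit_graded a c by simp
    qed
  qed
  have lins: "linear (\<lambda>c. atom_coeff (a * c))" "linear (\<lambda>a. atom_coeff (a * c))"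
    "linear (\<lambda>c. atom_coeff a * \<epsilon> c + \<epsilon> a * atom_coeff c)"
    "linear (\<lambda>a. atom_coeff a * \<epsilon> c + \<epsilon> a * atom_coeff c)" for a c
    using linear_atom_coeff counit_linear by (simp_all add: linear_iff algebra_simps)
  show ?thesis
    by (rule linear_eq_on_homogeneous[OF lins(2,4)])
      (rule linear_eq_on_homogeneous[OF lins(1,3)], rule hom)
qed

text \<open>The linear extension of \<open>D\<close>, made to vanish in degree \<open>0\<close>.\<close>

definition der :: "'h \<Rightarrow> 'h" where
  "der = act atom_coeff"

lemma linear_der: "linear der"
  unfolding der_def by (rule linear_act[OF linear_atom_coeff])

lemma der_mult: "der (x * y) = der x * y + x * der y"
  unfolding der_def by (rule act_mult[OF linear_atom_coeff atom_coeff_mult])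

lemma der_one: "der 1 = 0"
  unfolding der_def act_def comult_one
    tlift2_pure[OF bilinear_functional_scaleR[OF linear_atom_coeff]]
  using atom_coeff_homogeneous[OF one_in_H0] by simp

lemma der_H0: "x \<in> H 0 \<Longrightarrow> der x = 0"
  by (subst H0E) (auto simp: linear_cmul[OF linear_der] der_one)

text \<open>The atom coefficient on the left sees degree 1 only, which leaves degree
  \<open>m - 1\<close> on the right. So the contraction factors through the component that the
  hypothesis identifies as \<open>pt \<otimes> D x\<close>.\<close>

lemma der_eq_D:
  assumes m: "1 \<le> m" and x: "x \<in> B m"
  shows "der x = D x"
proof -
  let ?b = "\<lambda>a b. atom_coeff a *\<^sub>R (b :: 'h)"
  have b: "bilinear ?b" by (rule bilinear_functional_scaleR[OF linear_atom_coeff])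
  have idem: "atom_coeff (component H 1 a) = atom_coeff a" for a
    unfolding component_1 by (simp add: linear_cmul[OF linear_atom_coeff] atom_coeff_pt)
  have "der x = tlift2 ?b (tensor_component H [1, m - 1] (\<Delta> x))"
    unfolding der_def act_def
  proof (rule tlift2_cong_on_span[OF comult_graded[OF B_in_H[OF x]] b])
    show "linear (\<lambda>s. tlift2 ?b (tensor_component H [1, m - 1] s))"
      using linear_compose[OF linear_tensor_component linear_tlift2[OF b]] by (simp add: o_def)
    fix s assume "s \<in> {pure [a, b] | a b i j. i + j = m \<and> a \<in> H i \<and> b \<in> H j}"
    then obtain a b' i j where s: "s = pure [a, b']" "i + j = m" "a \<in> H i" "b' \<in> H j" by blast
    have "atom_coeff a *\<^sub>R b' = atom_coeff a *\<^sub>R component H (m - 1) b'"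
      using s atom_coeff_homogeneous[of a i] component_homogeneous[OF s(4)] by (cases "i = 1") auto
    then show "tlift2 ?b s = tlift2 ?b (tensor_component H [1, m - 1] s)"
      using idem by (simp add: s(1) tensor_component_pure tlift2_pure[OF b])
  qed
  also have "tensor_component H [1, m - 1] (\<Delta> x) = comult_parts H \<Delta> [1, m - 1] x"
    by (simp add: comult_parts_def iter_comult_def comult_first_pure_Cons[OF comult_linear])
  finally show ?thesis
    unfolding comult_parts_eq[OF m x] tlift2_pure[OF b] by (simp add: atom_coeff_pt)
qed

text \<open>Contracting \<open>\<Delta> pt\<close> with the atom coefficient on the left and the counit on the right, in
  either order, gives \<open>\<epsilon> (D pt) = 1\<close>.\<close>

lemma der_pt: "der pt = 1"
proof -
  have b: "bilinear (\<lambda>a b. atom_coeff a *\<^sub>R (b :: 'h))" "bilinear (\<lambda>a b. \<epsilon> b *\<^sub>R (a :: 'h))"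
    using linear_atom_coeff counit_linear by (auto simp: bilinear_def linear_iff algebra_simps)
  have "\<epsilon> (der pt) = tlift2 (\<lambda>a b. atom_coeff a * \<epsilon> b) (\<Delta> pt)"
    unfolding der_def act_def linear_comp_tlift2[OF b(1) counit_linear]
    by (simp add: linear_cmul[OF counit_linear])
  also have "\<dots> = atom_coeff (tlift2 (\<lambda>a b. \<epsilon> b *\<^sub>R a) (\<Delta> pt))"
    unfolding linear_comp_tlift2[OF b(2) linear_atom_coeff]
    by (simp add: linear_cmul[OF linear_atom_coeff] mult.commute)
  finally have "\<epsilon> (der pt) = 1" by (simp add: counit_right atom_coeff_pt)
  moreover have "der pt \<in> H 0"
    using der_eq_D[of 1 pt] D_in_B[of 1 pt] B_1 B_in_H[of _ 0] by simp
  ultimately show ?thesis using H0E[of "der pt"] by simp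
qed

text \<open>\<open>D pt\<close> lies in \<open>B 0\<close> and equals \<open>der pt = 1\<close>. As
  degree 0 is spanned by 1, a further element would break independence.\<close>

lemma B_0: "B 0 = {1}"
proof -
  have "D pt = 1" "D pt \<in> B 0" using der_eq_D[of 1 pt] D_in_B[of 1 pt] B_1 der_pt by auto
  moreover have "x = 1" if x: "x \<in> B 0" and one: "1 \<in> B 0" for x
  proof (rule ccontr)
    assume "x \<noteq> 1"
    then have "x \<in> span (B 0 - {x})"
      using H0E[OF B_in_H[OF x]] one by (metis insertE insert_Diff span_base span_scale x)
    then show False using independent_B[of 0] x by (auto simp: dependent_def)
  qed
  ultimately show ?thesis by auto
qed

text \<open>In positive degree \<open>der\<close> maps the basis into the next lower one; in degree
  0, where \<open>m - 1\<close> is truncated, it vanishes.\<close>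

lemma der_in_H:
  assumes "x \<in> H m"
  shows "der x \<in> H (m - 1)"
proof (cases "m = 0")
  case True
  then show ?thesis using assms der_H0 subspace_0[OF subspace_H] by simp
next
  case False
  have "der ` span (B m) = span (der ` B m)"
    by (rule linear_span_image[OF linear_der, symmetric])
  also have "\<dots> \<subseteq> span (B (m - 1))"
    using False der_eq_D[of m] D_in_B[of m] by (intro span_mono) auto
  finally show ?thesis using assms by (auto simp: span_B)
qed

section \<open>Powers of the derivation\<close>

lemma linear_der_funpow: "linear (der ^^ r)"
proof (induction r)
  case (Suc r)
  then show ?case using linear_compose[OF Suc linear_der] by (simp add: o_def)
qed (simp add: linear_id[unfolded id_def] id_def)

lemma der_funpow_in_H: "x \<in> H m \<Longrightarrow> (der ^^ r) x \<in> H (m - r)"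
proof (induction r)
  case (Suc r)
  then show ?case using der_in_H[of "(der ^^ r) x" "m - r"] by simp
qed simp

lemma der_funpow_eq_0: "x \<in> H m \<Longrightarrow> m < r \<Longrightarrow> (der ^^ r) x = 0"
proof (induction r)
  case (Suc r)
  have "(der ^^ r) x \<in> H (m - r)" by (rule der_funpow_in_H[OF Suc.prems(1)])
  \<comment> \<open>For \<open>r = m\<close> the degree reached is 0, and one more
    \<open>der\<close> gives 0.\<close>
  then show ?case using Suc der_H0 linear_0[OF linear_der] by (cases "m < r") auto
qed simp

text \<open>The bound keeps the degree positive before each step; on \<open>B 0\<close> nothing is
  assumed of \<open>D\<close>.\<close>

lemma der_funpow_eq_D:
  assumes "x \<in> B m" "r \<le> m"
  shows "(der ^^ r) x = (D ^^ r) x \<and> (D ^^ r) x \<in> B (m - r)"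
  using assms(2)
proof (induction r)
  case (Suc r)
  then have IH: "(der ^^ r) x = (D ^^ r) x" "(D ^^ r) x \<in> B (m - r)" by auto
  then show ?case
    using der_eq_D[of "m - r" "(D ^^ r) x"] D_in_B[of "m - r" "(D ^^ r) x"] Suc.prems by simp
qed (simp add: assms)

text \<open>The Leibniz rule with \<open>der pt = 1\<close>. At \<open>r = 0\<close> the truncated
  exponent comes with coefficient 0.\<close>

lemma der_pt_power_mult:
  "der (pt ^ r * y) = real r *\<^sub>R (pt ^ (r - 1) * y) + pt ^ r * der y"
proof (induction r)
  case (Suc r)
  have "der (pt ^ Suc r * y) = pt ^ r * y + pt * der (pt ^ r * y)"
    using der_mult[of pt "pt ^ r * y"] by (simp add: der_pt mult.assoc)
  also have "\<dots> = real (Suc r) *\<^sub>R (pt ^ r * y) + pt ^ Suc r * der y"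
    unfolding Suc by (cases r) (simp_all add: algebra_simps scaleR_2)
  finally show ?case by simp
qed simp

text \<open>\<open>pt\<close> is a slice of the locally nilpotent derivation, so the alternating series
  \<open>\<Sum>i. (-1)^i pt^(i+1) der^i z / (i+1)!\<close> is an antiderivative of \<open>z\<close>.\<close>

lemma der_surj:
  assumes z: "z \<in> H m"
  shows "\<exists>x \<in> H (Suc m). der x = z"
proof
  \<comment> \<open>\<open>der\<close> maps the summand \<open>?t i\<close> to
    \<open>u i - u (Suc i)\<close>, so the image of the sum telescopes.\<close>
  define u where "u i = ((-1) ^ i / fact i) *\<^sub>R (pt ^ i * (der ^^ i) z)" for i :: nat
  let ?t = "\<lambda>i. ((-1) ^ i / fact (Suc i)) *\<^sub>R (pt ^ Suc i * (der ^^ i) z)"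
  have "pt ^ r \<in> H r" for r
    by (induction r) (use one_in_H0 mult_graded[OF pt_in_H1] in auto)
  then show "(\<Sum>i\<le>m. ?t i) \<in> H (Suc m)"
    using mult_graded[OF _ der_funpow_in_H[OF z]]
    by (intro subspace_sum[OF subspace_H] subspace_scale[OF subspace_H])
      (metis Suc_diff_le add_Suc_right atMost_iff le_add_diff_inverse add_Suc)
  have "der (?t i) = u i - u (Suc i)" for i
  proof -
    have "real (Suc i) / fact (Suc i) = 1 / (fact i :: real)"
      by (simp add: field_simps del: of_nat_Suc)
    then have "(-1) ^ i * real (Suc i) / fact (Suc i) = (-1) ^ i / (fact i :: real)"
      by (metis times_divide_eq_right mult.right_neutral)
    then show ?thesis
      by (simp add: linear_cmul[OF linear_der] der_pt_power_mult u_def scaleR_add_right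
          del: power_Suc fact_Suc of_nat_Suc) simp
  qed
  then have "der (\<Sum>i\<le>m. ?t i) = (\<Sum>i\<le>m. u i - u (Suc i))"
    by (simp add: linear_sum[OF linear_der])
  also have "\<dots> = u 0 - u (Suc m)" by (rule sum_telescope)
  \<comment> \<open>The series may stop at \<open>m\<close> because \<open>der ^^ Suc m\<close>
    kills degree \<open>m\<close>.\<close>
  also have "\<dots> = z" using der_funpow_eq_0[OF z, of "Suc m"] by (simp add: u_def)
  finally show "der (\<Sum>i\<le>m. ?t i) = z" .
qed

text \<open>By surjectivity of \<open>der\<close> the image of \<open>D\<close> spans degree
  \<open>m\<close>. It is part of the independent set \<open>B m\<close>, so no element of
  \<open>B m\<close> can be missing.\<close>

lemma D_onto: "D ` B (Suc m) = B m"
proof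
  show sub: "D ` B (Suc m) \<subseteq> B m" using D_in_B[of "Suc m"] by auto
  have "H m \<subseteq> der ` span (B (Suc m))"
    using der_surj[of _ m] by (force simp: span_B)
  also have "\<dots> = span (der ` B (Suc m))"
    by (rule linear_span_image[OF linear_der, symmetric])
  also have "der ` B (Suc m) = D ` B (Suc m)"
    by (intro image_cong) (auto simp: der_eq_D[of "Suc m"])
  finally have sp: "B m \<subseteq> span (D ` B (Suc m))" using B_in_H by blast
  show "B m \<subseteq> D ` B (Suc m)"
  proof
    fix y assume y: "y \<in> B m"
    show "y \<in> D ` B (Suc m)"
    proof (rule ccontr)
      assume "y \<notin> D ` B (Suc m)"
      then have "span (D ` B (Suc m)) \<subseteq> span (B m - {y})"
        using sub by (intro span_mono) auto
      then show False using independent_B[of m] y sp by (auto simp: dependent_def)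
    qed
  qed
qed

lemma D_funpow_onto: "(D ^^ r) ` B (m + r) = B m"
proof (induction r)
  case (Suc r)
  have "(D ^^ Suc r) ` B (m + Suc r) = (D ^^ r) ` D ` B (Suc (m + r))"
    by (simp add: image_image funpow_swap1)
  then show ?case by (simp add: D_onto Suc)
qed simp

section \<open>The operators in terms of the deration\<close>

text \<open>The convolution power of \<open>atom_coeff\<close> with exponent \<open>Suc r\<close>;
  the shift matches the nonempty composition \<open>replicate (Suc r) 1\<close>.\<close>

primrec conv_power :: "nat \<Rightarrow> 'h \<Rightarrow> real" where
  "conv_power 0 = atom_coeff"
| "conv_power (Suc r) = conv (conv_power r) atom_coeff"

lemma linear_conv_power: "linear (conv_power r)"
  by (induction r) (auto simp: linear_atom_coeff intro: linear_conv)

lemma act_conv_power: "act (conv_power r) x = (der ^^ Suc r) x"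
  by (induction r) (simp_all add: act_conv linear_conv_power linear_atom_coeff der_def)

text \<open>Each degree 1 component is a multiple of \<open>pt\<close>, so the product is a multiple
  of a power of \<open>pt\<close>; the coefficients combine to a convolution power.\<close>

lemma tensor_mult_comult_parts_ones:
  "tensor_mult (comult_parts H \<Delta> (replicate (Suc r) 1) x) = conv_power r x *\<^sub>R pt ^ Suc r"
proof (induction r arbitrary: x)
  case 0
  then show ?case
    using tensor_mult_comult_parts_singleton[of 1 x] component_1[of x] by simp
next
  case (Suc r)
  \<comment> \<open>The recursion for compositions removes the last part, so the new 1 is moved to
    the end.\<close>
  have "replicate (Suc (Suc r)) 1 = replicate (Suc r) 1 @ [1 :: nat]"
    by (simp flip: replicate_append_same)
  then have "tensor_mult (comult_parts H \<Delta> (replicate (Suc (Suc r)) 1) x) =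
      tensor_mult (comult_parts H \<Delta> (replicate (Suc r) 1 @ [1]) x)"
    by (simp only:)
  also have "\<dots> =
      tlift2 (\<lambda>a b. tensor_mult (comult_parts H \<Delta> (replicate (Suc r) 1) a) * component H 1 b) (\<Delta> x)"
    by (rule tensor_mult_comult_parts_snoc) simp
  also have "\<dots> = tlift2 (\<lambda>a b. (conv_power r a *\<^sub>R pt ^ Suc r) * component H 1 b) (\<Delta> x)"
    unfolding Suc ..
  also have "\<dots> = tlift2 (\<lambda>a b. (conv_power r a * atom_coeff b) *\<^sub>R pt ^ Suc (Suc r)) (\<Delta> x)"
    unfolding component_1 by (simp add: power_commutes mult.assoc mult.commute[of "atom_coeff _"])
  also have "\<dots> = conv_power (Suc r) x *\<^sub>R pt ^ Suc (Suc r)"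
    unfolding conv_power.simps conv_def
    by (rule linear_comp_tlift2[OF bilinear_functional_mult[OF linear_conv_power linear_atom_coeff],
          symmetric])
      (simp add: linear_iff algebra_simps)
  finally show ?case .
qed

text \<open>For positive \<open>r\<close> the first \<open>r\<close> factors contribute
  \<open>pt ^ r\<close> and a convolution power of the atom coefficient, whose action on
  \<open>x\<close> is \<open>der ^^ r\<close>.\<close>

lemma tensor_mult_comult_top_parts:
  assumes x: "x \<in> H m"
  shows "tensor_mult (comult_parts H \<Delta> (top_parts r m) x) = pt ^ r * (der ^^ r) x"
proof (cases r)
  case 0
  \<comment> \<open>The extra part 0 contributes the scalar \<epsilon> on the left, which the counit
    law absorbs.\<close>
  have "tensor_mult (comult_parts H \<Delta> ([0] @ [m]) x) =
      tlift2 (\<lambda>a b. component H m (\<epsilon> a *\<^sub>R b)) (\<Delta> x)"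
    using tensor_mult_comult_parts_snoc[of "[0]" m x]
    by (simp add: tensor_mult_comult_parts_singleton component_0 linear_cmul[OF linear_component])
  also have "\<dots> = component H m (act \<epsilon> x)"
    unfolding act_def
    by (rule linear_comp_tlift2[OF bilinear_functional_scaleR[OF counit_linear] linear_component,
          symmetric])
  finally show ?thesis
    using 0 by (simp add: top_parts_def act_counit component_homogeneous[OF x])
next
  case (Suc r')
  let ?L = "\<lambda>z. pt ^ r * component H (m - r) z"
  have "tensor_mult (comult_parts H \<Delta> (top_parts r m) x) =
      tlift2 (\<lambda>a b. (conv_power r' a *\<^sub>R pt ^ r) * component H (m - r) b) (\<Delta> x)"
    using tensor_mult_comult_parts_snoc[of "replicate r 1" "m - r" x]
      tensor_mult_comult_parts_ones[of r'] Suc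
    by (simp add: top_parts_def)
  also have "\<dots> = tlift2 (\<lambda>a b. ?L (conv_power r' a *\<^sub>R b)) (\<Delta> x)"
    by (simp add: linear_cmul[OF linear_component])
  also have "\<dots> = ?L (act (conv_power r') x)"
    unfolding act_def
    by (rule linear_comp_tlift2[OF bilinear_functional_scaleR[OF linear_conv_power]
          linear_mult_right[OF linear_component], symmetric])
  \<comment> \<open>The projection to degree \<open>m - r\<close> acts as the identity, as
    \<open>der ^^ r\<close> already lands there.\<close>
  also have "\<dots> = pt ^ r * (der ^^ r) x"
    unfolding act_conv_power Suc[symmetric]
    using component_homogeneous[OF der_funpow_in_H[OF x]] by simp
  finally show ?thesis .
qed

section \<open>Closed forms of the operators and commutation with the derivation\<close>

lemma T2R_eq:
  assumes "1 \<le> m" "x \<in> B m"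
  shows "T2R H \<Delta> m x = (1 / real m) *\<^sub>R (pt * der x)"
  unfolding T2R_def comult_parts_eq[OF assms] tensor_mult_pure
  by (simp add: der_eq_D[OF assms])

lemma BinT2R_eq:
  assumes "x \<in> H m"
  shows "BinT2R H \<Delta> q m x =
    (\<Sum>r\<le>m. (1 / fact r * (1 - q) ^ r * q ^ (m - r)) *\<^sub>R (pt ^ r * (der ^^ r) x))"
  unfolding BinT2R_def tensor_mult_comult_top_parts[OF assms] by (simp add: atLeast0AtMost)

text \<open>The Leibniz rule gives two sums; after an index shift in the first,
  \<open>(1 - q) + q = 1\<close> merges their coefficients.\<close>

lemma der_BinT2R:
  assumes x: "x \<in> H (Suc m)"
  shows "der (BinT2R H \<Delta> q (Suc m) x) = BinT2R H \<Delta> q m (der x)"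
proof -
  define c where "c n r = 1 / fact r * (1 - q) ^ r * q ^ (n - r)" for n r :: nat
  define v where "v s = pt ^ s * (der ^^ Suc s) x" for s
  have "der (BinT2R H \<Delta> q (Suc m) x) =
      (\<Sum>r\<le>Suc m. (c (Suc m) r * real r) *\<^sub>R (pt ^ (r - 1) * (der ^^ r) x))
      + (\<Sum>r\<le>Suc m. c (Suc m) r *\<^sub>R v r)"
    unfolding BinT2R_eq[OF x] c_def[symmetric] v_def
    by (simp add: linear_sum[OF linear_der] linear_cmul[OF linear_der] der_pt_power_mult
        scaleR_add_right sum.distrib del: sum.atMost_Suc)
  \<comment> \<open>The term for \<open>r = 0\<close> has the factor \<open>real r = 0\<close>; the
    others are shifted by one.\<close>
  also have "(\<Sum>r\<le>Suc m. (c (Suc m) r * real r) *\<^sub>R (pt ^ (r - 1) * (der ^^ r) x)) =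
      (\<Sum>s\<le>m. (c (Suc m) (Suc s) * real (Suc s)) *\<^sub>R v s)"
    unfolding sum.atMost_Suc_shift v_def by simp
  \<comment> \<open>The top term vanishes: \<open>der ^^ Suc (Suc m)\<close> kills degree
    \<open>Suc m\<close>.\<close>
  also have "(\<Sum>r\<le>Suc m. c (Suc m) r *\<^sub>R v r) = (\<Sum>s\<le>m. c (Suc m) s *\<^sub>R v s)"
    using der_funpow_eq_0[OF x, of "Suc (Suc m)"] by (simp add: v_def)
  also have "(\<Sum>s\<le>m. (c (Suc m) (Suc s) * real (Suc s)) *\<^sub>R v s) + \<dots> = (\<Sum>s\<le>m. c m s *\<^sub>R v s)"
    unfolding sum.distrib[symmetric] scaleR_add_left[symmetric]
  proof (intro sum.cong refl arg_cong2[where f = scaleR])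
    fix s assume "s \<in> {..m}"
    then have "Suc m - s = Suc (m - s)" by auto
    moreover have "real (Suc s) / fact (Suc s) = 1 / (fact s :: real)"
      by (simp add: field_simps del: of_nat_Suc)
    then have "c (Suc m) (Suc s) * real (Suc s) = 1 / fact s * (1 - q) ^ Suc s * q ^ (m - s)"
      unfolding c_def by (simp add: field_simps del: of_nat_Suc fact_Suc power_Suc)
    ultimately show "c (Suc m) (Suc s) * real (Suc s) + c (Suc m) s = c m s"
      by (simp add: c_def algebra_simps)
  qed
  also have "\<dots> = BinT2R H \<Delta> q m (der x)"
    using BinT2R_eq[OF der_in_H[OF x], of q]
    by (simp add: c_def v_def funpow_swap1)
  finally show ?thesis .
qed

lemma der_funpow_BinT2R:
  assumes "x \<in> H (m + r)"
  shows "(der ^^ r) (BinT2R H \<Delta> q (m + r) x) = BinT2R H \<Delta> q m ((der ^^ r) x)"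
  using assms
proof (induction r arbitrary: x)
  case (Suc r)
  then have "x \<in> H (Suc (m + r))" by simp
  then show ?case
    using der_BinT2R[of x "m + r" q] Suc.IH[of "der x"] der_in_H[of x "Suc (m + r)"]
    by (simp add: funpow_swap1)
qed simp

text \<open>Since \<open>der pt = 1\<close> and \<open>der 1 = 0\<close>, only two terms of the
  iterated Leibniz rule survive.\<close>

lemma der_funpow_pt_mult:
  "(der ^^ r) (pt * y) = pt * (der ^^ r) y + real r *\<^sub>R (der ^^ (r - 1)) y"
proof (induction r)
  case (Suc r)
  have "(der ^^ Suc r) (pt * y) =
      der (pt * (der ^^ r) y) + real r *\<^sub>R der ((der ^^ (r - 1)) y)"
    by (simp add: Suc linear_add[OF linear_der] linear_cmul[OF linear_der])
  also have "real r *\<^sub>R der ((der ^^ (r - 1)) y) = real r *\<^sub>R (der ^^ r) y"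
    by (cases r) auto
  finally show ?case by (simp add: der_mult der_pt algebra_simps)
qed simp

text \<open>The last term is the lazy part: for \<open>r = n - k\<close> its factor is the holding
  probability.\<close>

lemma der_funpow_T2R:
  assumes x: "x \<in> B n" and n: "1 \<le> n"
  shows "(der ^^ r) (T2R H \<Delta> n x) =
    (1 / real n) *\<^sub>R (pt * der ((der ^^ r) x)) + (real r / real n) *\<^sub>R (der ^^ r) x"
proof -
  have "real r *\<^sub>R (der ^^ (r - 1)) (der x) = real r *\<^sub>R (der ^^ r) x"
    by (cases r) (auto simp: funpow_swap1)
  then show ?thesis
    by (simp add: T2R_eq[OF n x] linear_cmul[OF linear_der_funpow] der_funpow_pt_mult
        funpow_swap1 scaleR_add_right)
      (metis (no_types, lifting) mult.left_neutral scaleR_scaleR times_divide_eq_left)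
qed

section \<open>The chains\<close>

text \<open>Expand in the basis and multiply each term by \<open>pt\<close>; the coefficients stay
  nonnegative. Membership in the graded piece is carried along because additivity of
  \<open>representation\<close> is available only inside the span.\<close>

lemma pt_power_mult_nonneg:
  assumes z: "z \<in> B m"
  shows "pt ^ r * z \<in> H (m + r)" "y \<in> B (m + r) \<Longrightarrow> 0 \<le> representation (B (m + r)) (pt ^ r * z) y"
proof -
  have "pt ^ r * z \<in> H (m + r) \<and> (\<forall>y\<in>B (m + r). 0 \<le> representation (B (m + r)) (pt ^ r * z) y)"
  proof (induction r)
    case 0
    then show ?case
      using z by (auto simp: B_in_H real_vector.representation_basis[OF independent_B])
  next
    case (Suc r)
    let ?w = "pt ^ r * z" and ?C = "B (m + r)" and ?C' = "B (m + Suc r)"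
    have in_H: "pt * y \<in> H (m + Suc r)" if "y \<in> H (m + r)" for y
      using mult_graded[OF pt_in_H1 that] by simp
    have "pt * ?w = pt * (\<Sum>y\<in>?C. representation ?C ?w y *\<^sub>R y)"
      using real_vector.sum_representation_eq[OF independent_B _ finite_B, of ?w "m + r"] Suc
      by (simp add: span_B)
    then have w: "pt * ?w = (\<Sum>y\<in>?C. representation ?C ?w y *\<^sub>R (pt * y))"
      by (simp add: sum_distrib_left)
    have "0 \<le> representation ?C' (pt * ?w) y" if "y \<in> ?C'" for y
      unfolding w
      using Suc that pt_mult_nonneg[of "m + Suc r" _ y] in_H[OF B_in_H]
      by (simp add: real_vector.representation_sum[OF independent_B] span_B subspace_scale[OF subspace_H]
          real_vector.representation_scale[OF independent_B] sum_nonneg)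
    then show ?case
      using in_H[of ?w] Suc by (simp add: mult.assoc)
  qed
  then show "pt ^ r * z \<in> H (m + r)"
    "y \<in> B (m + r) \<Longrightarrow> 0 \<le> representation (B (m + r)) (pt ^ r * z) y" by auto
qed

text \<open>\<open>der ^^ n\<close> sends every element of \<open>B n\<close> to 1, so applied to
  \<open>T x\<close> it reads off the sum of the coefficients, which is the row sum.\<close>

lemma transition_matrix_driven:
  assumes T_in: "\<And>x. x \<in> B n \<Longrightarrow> T x \<in> H n"
    and nonneg: "\<And>x y. x \<in> B n \<Longrightarrow> y \<in> B n \<Longrightarrow> 0 \<le> representation (B n) (T x) y"
    and one: "\<And>x. x \<in> B n \<Longrightarrow> (der ^^ n) (T x) = 1"
  shows "transition_matrix (B n) (driven_matrix (B n) T)"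
  unfolding transition_matrix_def driven_matrix_def
proof (intro conjI ballI)
  fix x assume x: "x \<in> B n"
  have top: "(der ^^ n) y = 1" if "y \<in> B n" for y
    using der_funpow_eq_D[OF that order_refl] B_0 by simp
  have "representation (B 0) ((der ^^ n) (T x)) 1 =
      (\<Sum>y | y \<in> B n \<and> (der ^^ n) y = 1. representation (B n) (T x) y)"
    by (rule representation_linear_image[OF independent_B finite_B independent_B linear_der_funpow])
      (use top T_in x in \<open>auto simp: B_0 span_B\<close>)
  also have "{y. y \<in> B n \<and> (der ^^ n) y = 1} = B n" using top by auto
  finally show "(\<Sum>y\<in>B n. representation (B n) (T x) y) = 1"
    using one[OF x] real_vector.representation_basis[OF independent_B, of 1 0] by (simp add: B_0)
qed (auto simp: finite_B nonneg)

text \<open>As \<open>der ^^ (n - k)\<close> is linear and agrees with \<open>D ^^ (n - k)\<close>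
  on \<open>B n\<close>, its value at \<open>T x\<close> has the fibre sums of row \<open>x\<close>
  as coefficients.\<close>

lemma lumps_via_D_funpow:
  assumes T: "transition_matrix (B n) (driven_matrix (B n) T)" and kn: "k \<le> n"
    and T_in: "\<And>x. x \<in> B n \<Longrightarrow> T x \<in> H n"
    and T': "\<And>x z. x \<in> B n \<Longrightarrow> z \<in> B k \<Longrightarrow>
      representation (B k) ((der ^^ (n - k)) (T x)) z = K' ((D ^^ (n - k)) x) z"
  shows "lumps_via M (B n) (driven_matrix (B n) T) (D ^^ (n - k)) (B k) K'"
proof (rule lumps_viaI[OF T])
  show "(D ^^ (n - k)) ` B n = B k" using D_funpow_onto[of "n - k" k] kn by simp
  fix x z assume x: "x \<in> B n" and z: "z \<in> B k"
  have D: "(der ^^ (n - k)) y = (D ^^ (n - k)) y \<and> (D ^^ (n - k)) y \<in> B k" if "y \<in> B n" for y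
    using der_funpow_eq_D[OF that, of "n - k"] kn by simp
  have "representation (B k) ((der ^^ (n - k)) (T x)) z =
      (\<Sum>y | y \<in> B n \<and> (der ^^ (n - k)) y = z. representation (B n) (T x) y)"
    by (rule representation_linear_image[OF independent_B finite_B independent_B linear_der_funpow])
      (use D T_in x in \<open>auto simp: span_B\<close>)
  also have "{y. y \<in> B n \<and> (der ^^ (n - k)) y = z} = {y. y \<in> B n \<and> (D ^^ (n - k)) y = z}"
    using D by auto
  finally show "(\<Sum>y | y \<in> B n \<and> (D ^^ (n - k)) y = z. driven_matrix (B n) T x y) =
      K' ((D ^^ (n - k)) x) z"
    using T'[OF x z] by (simp add: driven_matrix_def)
qed

section \<open>The two lumpings\<close>

lemma lumps_via_T2R:
  assumes k: "1 \<le> k" and kn: "k \<le> n"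
  shows "lumps_via M (B n) (driven_matrix (B n) (T2R H \<Delta> n)) (D ^^ (n - k))
    (B k) (lazy (real (n - k) / real n) (driven_matrix (B k) (T2R H \<Delta> k)))"
proof (rule lumps_via_D_funpow[OF transition_matrix_driven kn])
  have n: "1 \<le> n" using k kn by simp
  fix x assume x: "x \<in> B n"
  have Dx: "der x \<in> B (n - 1)" using der_eq_D[OF n x] D_in_B[OF n x] by simp
  note pos = pt_power_mult_nonneg(1)[OF Dx, of 1] pt_power_mult_nonneg(2)[OF Dx, of _ 1]
  \<comment> \<open>Membership is a premise both of stochasticity and of the lumping, hence the
    repetition.\<close>
  show "T2R H \<Delta> n x \<in> H n" "T2R H \<Delta> n x \<in> H n"
    using pos n by (auto simp: T2R_eq[OF n x] intro: subspace_scale[OF subspace_H])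
  show "0 \<le> representation (B n) (T2R H \<Delta> n x) y" if "y \<in> B n" for y
    using pos that n
    by (simp add: T2R_eq[OF n x] real_vector.representation_scale[OF independent_B] span_B)
  have "(der ^^ n) x = 1" using der_funpow_eq_D[OF x order_refl] B_0 by simp
  \<comment> \<open>With \<open>r = n\<close> the first term vanishes since
    \<open>der 1 = 0\<close>, and the second has factor \<open>n / n\<close>.\<close>
  then show "(der ^^ n) (T2R H \<Delta> n x) = 1"
    using n by (simp add: der_funpow_T2R[OF x n] der_one)
  fix z assume z: "z \<in> B k"
  let ?x = "(D ^^ (n - k)) x"
  have x': "(der ^^ (n - k)) x = ?x" "?x \<in> B k"
    using der_funpow_eq_D[OF x, of "n - k"] kn by auto
  have T_in: "pt * der ?x \<in> H k"
    using mult_graded[OF pt_in_H1 der_in_H[OF B_in_H[OF x'(2)]]] k by simp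
  \<comment> \<open>\<open>pt * der ?x\<close> is \<open>k\<close> times the operator in degree
    \<open>k\<close>, which turns the factor \<open>1 / n\<close> into the moving probability
    \<open>k / n\<close>.\<close>
  have eq: "(der ^^ (n - k)) (T2R H \<Delta> n x) =
      (real k / real n) *\<^sub>R T2R H \<Delta> k ?x + (real (n - k) / real n) *\<^sub>R ?x"
    using k by (simp add: der_funpow_T2R[OF x n] x' T2R_eq[OF k x'(2)])
  have "1 - real (n - k) / real n = real k / real n"
    using n kn by (simp add: field_simps of_nat_diff)
  then show "representation (B k) ((der ^^ (n - k)) (T2R H \<Delta> n x)) z =
      lazy (real (n - k) / real n) (driven_matrix (B k) (T2R H \<Delta> k)) ?x z"
    unfolding eq lazy_def driven_matrix_def T2R_eq[OF k x'(2)]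
    using T_in B_in_H[OF x'(2)]
    by (simp add: real_vector.representation_add[OF independent_B]
        real_vector.representation_scale[OF independent_B] span_B subspace_scale[OF subspace_H]
        real_vector.representation_basis[OF independent_B x'(2)])
qed

lemma lumps_via_BinT2R:
  assumes kn: "k \<le> n" and q: "0 \<le> q" "q \<le> 1"
  shows "lumps_via M (B n) (driven_matrix (B n) (BinT2R H \<Delta> q n)) (D ^^ (n - k))
    (B k) (driven_matrix (B k) (BinT2R H \<Delta> q k))"
proof (rule lumps_via_D_funpow[OF transition_matrix_driven kn])
  fix x assume x: "x \<in> B n"
  note xH = B_in_H[OF x]
  have Dx: "(der ^^ r) x \<in> B (n - r)" if "r \<le> n" for r
    using der_funpow_eq_D[OF x that] by simp
  have term_in: "pt ^ r * (der ^^ r) x \<in> H n" if "r \<le> n" for r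
    using pt_power_mult_nonneg(1)[OF Dx[OF that], of r] that by simp
  have term_nonneg: "0 \<le> representation (B n) (pt ^ r * (der ^^ r) x) y" if "r \<le> n" "y \<in> B n" for r y
    using pt_power_mult_nonneg(2)[OF Dx[OF that(1)], of y r] that by simp
  show "BinT2R H \<Delta> q n x \<in> H n" "BinT2R H \<Delta> q n x \<in> H n"
    unfolding BinT2R_eq[OF xH]
    by (auto intro!: subspace_sum[OF subspace_H] subspace_scale[OF subspace_H] term_in)
  \<comment> \<open>The weights are nonnegative because \<open>q\<close> lies in the unit
    interval.\<close>
  show "0 \<le> representation (B n) (BinT2R H \<Delta> q n x) y" if "y \<in> B n" for y
    unfolding BinT2R_eq[OF xH]
    using q that term_in term_nonneg
    by (subst real_vector.representation_sum[OF independent_B])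
      (auto simp: span_B real_vector.representation_scale[OF independent_B]
        intro!: subspace_scale[OF subspace_H] sum_nonneg)
  have "(der ^^ n) x = 1" using der_funpow_eq_D[OF x order_refl] B_0 by simp
  \<comment> \<open>Commutation down to degree 0 leaves the operator applied to 1, whose only term
    is \<open>r = 0\<close> with weight 1.\<close>
  then show "(der ^^ n) (BinT2R H \<Delta> q n x) = 1"
    using der_funpow_BinT2R[of x 0 n q] xH BinT2R_eq[OF one_in_H0] by simp
  show "representation (B k) ((der ^^ (n - k)) (BinT2R H \<Delta> q n x)) z =
      driven_matrix (B k) (BinT2R H \<Delta> q k) ((D ^^ (n - k)) x) z" for z
    using der_funpow_BinT2R[of x k "n - k" q] der_funpow_eq_D[OF x, of "n - k"] xH kn
    by (simp add: driven_matrix_def)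
qed

end

theorem theorem4p10:
  fixes H :: "nat \<Rightarrow> 'h::real_algebra_1 set"
    and \<Delta> :: "'h \<Rightarrow> 'h tensor"
    and \<epsilon> :: "'h \<Rightarrow> real"
    and S :: "'h \<Rightarrow> 'h"
    and B :: "nat \<Rightarrow> 'h set"
    and pt :: 'h
    and D :: "'h \<Rightarrow> 'h"
    and n k :: nat
    and q\<^sub>2 :: real
    and M :: "'w measure"
  assumes "graded_connected_hopf_algebra H \<Delta> \<epsilon> S"
    and "graded_basis H B"
    and "B 1 = {pt}"
    and "\<And>m x. 1 \<le> m \<Longrightarrow> x \<in> B m \<Longrightarrow>
           D x \<in> B (m - 1) \<and> comult_parts H \<Delta> [1, m - 1] x = pure [pt, D x]"
    and "\<And>m z y. 1 \<le> m \<Longrightarrow> z \<in> B (m - 1) \<Longrightarrow> y \<in> B m \<Longrightarrow>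
           0 \<le> representation (B m) (pt * z) y"
    and "1 \<le> k" and "k \<le> n"
    and "0 \<le> q\<^sub>2" and "q\<^sub>2 \<le> 1"
  shows "lumps_via M (B n) (driven_matrix (B n) (T2R H \<Delta> n)) (D ^^ (n - k))
           (B k) (lazy (real (n - k) / real n) (driven_matrix (B k) (T2R H \<Delta> k))) \<and>
         lumps_via M (B n) (driven_matrix (B n) (BinT2R H \<Delta> q\<^sub>2 n)) (D ^^ (n - k))
           (B k) (driven_matrix (B k) (BinT2R H \<Delta> q\<^sub>2 k))"
proof -
  interpret single_atom_hopf_algebra H \<Delta> \<epsilon> S B pt D
    using assms(1) by (rule single_atom_hopf_algebra.intro)
      (unfold_locales, use assms(2-5) in auto)
  show ?thesis
    using lumps_via_T2R lumps_via_BinT2R assms(6-9) by blast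
qed

end
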